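(* Let $\mathcal{H}$ be a Hilbert space. Let $\mathfrak{T}\subset B(\mathcal{H})$ be a unital $\mathrm{C}^*$-subalgebra and let $\mathcal{A}\subset\mathfrak{T}$ be a unital norm-closed subalgebra. Assume that $\mathfrak{T}$ contains the ideal of compact operators on $\mathcal{H}$. Assume also that there is a dense set $\Gamma\subset\mathcal{H}$ consisting of non-cyclic vectors for $\{a^*:a\in\mathcal{A}\}$. Then, for every pair of vectors $h,k\in\mathcal{H}$, the functional $t\mapsto\langle th,k\rangle$, $t\in\mathfrak{T}$, lies in $\operatorname{AC}(\Delta)$. In particular, the triple $\mathcal{A}\subset\mathfrak{T}\subset B(\mathcal{H})$ is analytic.
   Context: The bidual $\mathfrak{T}^{**}$ is regarded as a von Neumann algebra containing $\mathfrak{T}$ as a weak-$*$ dense $\mathrm{C}^*$-subalgebra. For $\phi\in\mathfrak{T}^*$, $\widehat\phi$ denotes its unique weak-$*$ continuous extension to $\mathfrak{T}^{**}$. There are a unique partial isometry $v_\phi\in\mathfrak{T}^{**}$ and a unique weak-$*$ continuous positive linear functional $|\phi|$ on $\mathfrak{T}^{**}$ with $\widehat\phi(\xi)=|\phi|(\xi v_\phi)$ for $\xi\in\mathfrak{T}^{**}$ and $\mathfrak{T}^{**}(I-v_\phi^*v_\phi)=\{\xi:|\phi|(\xi^*\xi)=0\}$; $|\phi|$ is also identified with its restriction to $\mathfrak{T}$. For $\phi,\psi\in\mathfrak{T}^*$, $\phi\ll\psi$ means: for $\xi\in\mathfrak{T}^{**}$, $|\psi|(\xi^*\xi)=0$ implies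 $|\phi|(\xi^*\xi)=0$. With $\mathcal{A}^\perp=\{\phi\in\mathfrak{T}^*:\phi|_{\mathcal{A}}=0\}$, $\Delta\subset\mathfrak{T}^*$ is the norm closure of the convex hull of $\{|\phi|:\phi\in\mathcal{A}^\perp,\|\phi\|=1\}$, and $\operatorname{AC}(\Delta)=\{\phi\in\mathfrak{T}^*:\phi\ll\delta\text{ for some }\delta\in\Delta\}$. The triple $\mathcal{A}\subset\mathfrak{T}\subset B(\mathcal{H})$ is analytic if a bounded net $(b_i)$ in $\mathcal{A}$ converges to $0$ in the weak-$*$ topology of $B(\mathcal{H})$ whenever $\lim_i\alpha(b_i)=0$ for all $\alpha\in\operatorname{AC}(\Delta)$. A vector $x$ is cyclic for a set $S$ of operators forming an algebra if $\{sx:s\in S\}$ is dense in $\mathcal{H}$. *)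

theory Defs
  imports "HOL-Analysis.Analysis" "HOL-Library.Function_Algebras"
begin

section \<open>Complex vector spaces and Hilbert spaces\<close>

class complex_vector = real_vector +
  fixes scaleC :: "complex \<Rightarrow> 'a \<Rightarrow> 'a"  (infixr \<open>*\<^sub>C\<close> 75)
  assumes scaleC_add_right: "a *\<^sub>C (x + y) = a *\<^sub>C x + a *\<^sub>C y"
    and scaleC_add_left: "(a + b) *\<^sub>C x = a *\<^sub>C x + b *\<^sub>C x"
    and scaleC_scaleC: "a *\<^sub>C (b *\<^sub>C x) = (a * b) *\<^sub>C x"
    and scaleC_one: "1 *\<^sub>C x = x"
    and scaleR_scaleC: "r *\<^sub>R x = complex_of_real r *\<^sub>C x"

text \<open>The inner product is linear in the first argument. Completeness comes from the class
  \<^class>\<open>banach\<close>; there is no restriction on the dimension.\<close>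

class chilbert_space = complex_vector + banach +
  fixes cinner :: "'a \<Rightarrow> 'a \<Rightarrow> complex"
  assumes cinner_commute: "cinner x y = cnj (cinner y x)"
    and cinner_add_left: "cinner (x + y) z = cinner x z + cinner y z"
    and cinner_scaleC_left: "cinner (a *\<^sub>C x) y = a * cinner x y"
    and cinner_self: "cinner x x = complex_of_real ((norm x)\<^sup>2)"

lemma norm_scaleC:
  fixes x :: "'a::chilbert_space"
  shows "norm (a *\<^sub>C x) = cmod a * norm x"
proof -
  have "cinner (a *\<^sub>C x) (a *\<^sub>C x) = a * cnj (cinner (a *\<^sub>C x) x)"
    by (metis cinner_commute cinner_scaleC_left)
  also have "\<dots> = complex_of_real ((cmod a * norm x)\<^sup>2)"
    by (simp add: cinner_scaleC_left cinner_self power_mult_distrib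
        complex_norm_square[symmetric] flip: mult.assoc)
  finally have "(norm (a *\<^sub>C x))\<^sup>2 = (cmod a * norm x)\<^sup>2"
    unfolding cinner_self of_real_eq_iff .
  then show ?thesis
    by simp
qed

instantiation complex :: chilbert_space
begin

definition scaleC_complex :: "complex \<Rightarrow> complex \<Rightarrow> complex"
  where "scaleC_complex a x = a * x"

definition cinner_complex :: "complex \<Rightarrow> complex \<Rightarrow> complex"
  where "cinner_complex x y = x * cnj y"

instance
  by standard
    (simp_all add: scaleC_complex_def cinner_complex_def algebra_simps scaleR_conv_of_real
      complex_norm_square[symmetric])

end

instantiation "fun" :: (type, real_vector) real_vector
begin

definition scaleR_fun :: "real \<Rightarrow> ('a \<Rightarrow> 'b) \<Rightarrow> 'a \<Rightarrow> 'b"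
  where "scaleR_fun r f = (\<lambda>x. r *\<^sub>R f x)"

instance
  by standard (simp_all add: scaleR_fun_def fun_eq_iff algebra_simps)

end

instantiation "fun" :: (type, complex_vector) complex_vector
begin

definition scaleC_fun :: "complex \<Rightarrow> ('a \<Rightarrow> 'b) \<Rightarrow> 'a \<Rightarrow> 'b"
  where "scaleC_fun c f = (\<lambda>x. c *\<^sub>C f x)"

instance
  by standard
    (simp_all add: scaleC_fun_def scaleR_fun_def fun_eq_iff scaleC_add_right scaleC_add_left
      scaleC_scaleC scaleC_one scaleR_scaleC)

end

instantiation blinfun :: (real_normed_vector, chilbert_space) complex_vector
begin

lift_definition scaleC_blinfun :: "complex \<Rightarrow> 'a \<Rightarrow>\<^sub>L 'b \<Rightarrow> 'a \<Rightarrow>\<^sub>L 'b"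
  is "\<lambda>c f x. c *\<^sub>C f x"
proof -
  fix c :: complex and f :: "'a \<Rightarrow> 'b"
  assume "bounded_linear f"
  then interpret f: bounded_linear f .
  show "bounded_linear (\<lambda>x. c *\<^sub>C f x)"
  proof (rule bounded_linear_intro[where K = "cmod c * onorm f"])
    show "c *\<^sub>C f (x + y) = c *\<^sub>C f x + c *\<^sub>C f y" for x y
      by (simp add: f.add scaleC_add_right)
    show "c *\<^sub>C f (r *\<^sub>R x) = r *\<^sub>R (c *\<^sub>C f x)" for r x
      by (simp add: f.scaleR scaleR_scaleC scaleC_scaleC mult.commute)
    show "norm (c *\<^sub>C f x) \<le> norm x * (cmod c * onorm f)" for x
      using mult_left_mono[OF onorm[OF f.bounded_linear_axioms, of x], of "cmod c"]
      by (simp add: norm_scaleC mult_ac)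
  qed
qed

instance
  by standard
    (transfer; simp add: fun_eq_iff scaleC_add_right scaleC_add_left scaleC_scaleC scaleC_one
      scaleR_scaleC)+

end

definition csubspace :: "'a::complex_vector set \<Rightarrow> bool"
  where "csubspace X \<longleftrightarrow>
    0 \<in> X \<and> (\<forall>x\<in>X. \<forall>y\<in>X. x + y \<in> X) \<and> (\<forall>c. \<forall>x\<in>X. c *\<^sub>C x \<in> X)"

definition clinear_on :: "'a::complex_vector set \<Rightarrow> ('a \<Rightarrow> complex) \<Rightarrow> bool"
  where "clinear_on X f \<longleftrightarrow>
    (\<forall>x\<in>X. \<forall>y\<in>X. f (x + y) = f x + f y) \<and> (\<forall>c. \<forall>x\<in>X. f (c *\<^sub>C x) = c * f x)"

text \<open>A functional on a subspace \<open>X\<close> is represented by a function on the whole type that vanishes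
  outside \<open>X\<close>; such functions form a vector space under the pointwise operations.\<close>

definition zero_ext :: "'a set \<Rightarrow> ('a \<Rightarrow> complex) \<Rightarrow> 'a \<Rightarrow> complex"
  where "zero_ext X f = (\<lambda>x. if x \<in> X then f x else 0)"

definition cdual :: "'a::complex_vector set \<Rightarrow> ('a \<Rightarrow> real) \<Rightarrow> ('a \<Rightarrow> complex) set"
  where "cdual X N = {f. clinear_on X f \<and> (\<exists>K. \<forall>x\<in>X. cmod (f x) \<le> K * N x) \<and>
    (\<forall>x. x \<notin> X \<longrightarrow> f x = 0)}"

definition weak_topology :: "'a set \<Rightarrow> ('a \<Rightarrow> complex) set \<Rightarrow> 'a topology"
  where "weak_topology X \<F> = topology_generated_by {{x \<in> X. f x \<in> U} |f U. f \<in> \<F> \<and> open U}"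


section \<open>Operators\<close>

text \<open>\<^typ>\<open>'h \<Rightarrow>\<^sub>L 'h\<close> is the space of bounded \<^emph>\<open>real\<close>-linear operators;
  \<open>BH\<close> consists of the complex-linear ones.\<close>

type_synonym 'h op = "'h \<Rightarrow>\<^sub>L 'h"

definition BH :: "'h::chilbert_space op set"
  where "BH = {t. \<forall>c x. blinfun_apply t (c *\<^sub>C x) = c *\<^sub>C blinfun_apply t x}"

definition adj :: "'h::chilbert_space op \<Rightarrow> 'h op"
  where "adj t = (THE s. \<forall>x y. cinner (blinfun_apply t x) y = cinner x (blinfun_apply s y))"

definition unital_closed_subalgebra :: "'h::chilbert_space op set \<Rightarrow> bool"
  where "unital_closed_subalgebra A \<longleftrightarrow>
    A \<subseteq> BH \<and> csubspace A \<and> closed A \<and> id_blinfun \<in> A \<and> (\<forall>a\<in>A. \<forall>b\<in>A. a o\<^sub>L b \<in> A)"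

definition unital_cstar_subalgebra :: "'h::chilbert_space op set \<Rightarrow> bool"
  where "unital_cstar_subalgebra T \<longleftrightarrow> unital_closed_subalgebra T \<and> (\<forall>t\<in>T. adj t \<in> T)"

definition compact_operators :: "'h::chilbert_space op set"
  where "compact_operators = {t \<in> BH. compact (closure (blinfun_apply t ` cball 0 1))}"

definition cyclic_vector :: "'h::chilbert_space op set \<Rightarrow> 'h \<Rightarrow> bool"
  where "cyclic_vector S x \<longleftrightarrow> closure {blinfun_apply s x |s. s \<in> S} = UNIV"

text \<open>The weak-* (ultraweak) topology of \<open>B(H)\<close>: the predual consists of the functionals
  \<open>b \<mapsto> \<Sum>\<^sub>n \<langle>b x\<^sub>n, y\<^sub>n\<rangle>\<close> with square-summable sequences \<open>x\<close> and \<open>y\<close>, i.e. of the functionals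
  \<open>b \<mapsto> tr(bs)\<close> with \<open>s = \<Sum>\<^sub>n \<langle>\<cdot>, y\<^sub>n\<rangle> x\<^sub>n\<close> of trace class.\<close>

definition predual_BH :: "('h::chilbert_space op \<Rightarrow> complex) set"
  where "predual_BH = {\<lambda>b. \<Sum>n. cinner (blinfun_apply b (x n)) (y n) |x y.
    summable (\<lambda>n::nat. (norm (x n))\<^sup>2) \<and> summable (\<lambda>n. (norm (y n))\<^sup>2)}"

definition weak_star_BH :: "'h::chilbert_space op topology"
  where "weak_star_BH = weak_topology BH predual_BH"


section \<open>Dual and bidual of an algebra of operators\<close>

type_synonym 'h functional = "'h op \<Rightarrow> complex"
type_synonym 'h bifunctional = "'h functional \<Rightarrow> complex"

definition dual :: "'h::chilbert_space op set \<Rightarrow> 'h functional set"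
  where "dual T = cdual T norm"

definition dual_norm :: "'h::chilbert_space op set \<Rightarrow> 'h functional \<Rightarrow> real"
  where "dual_norm T \<phi> = Sup {cmod (\<phi> t) |t. t \<in> T \<and> norm t \<le> 1}"

definition bidual :: "'h::chilbert_space op set \<Rightarrow> 'h bifunctional set"
  where "bidual T = cdual (dual T) (dual_norm T)"

definition embed :: "'h::chilbert_space op set \<Rightarrow> 'h op \<Rightarrow> 'h bifunctional"
  where "embed T t = zero_ext (dual T) (\<lambda>\<phi>. \<phi> t)"

definition weak_star_bidual :: "'h::chilbert_space op set \<Rightarrow> 'h bifunctional topology"
  where "weak_star_bidual T = weak_topology (bidual T) {\<lambda>\<xi>. \<xi> \<phi> |\<phi>. \<phi> \<in> dual T}"

text \<open>The von Neumann algebra structure of the bidual of a C*-algebra is given by the Arens product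
  \<open>(\<xi> \<eta>)(\<phi>) = \<xi>(\<eta> \<cdot> \<phi>)\<close>, where \<open>(\<eta> \<cdot> \<phi>)(a) = \<eta>(\<phi> \<cdot> a)\<close> and \<open>(\<phi> \<cdot> a)(b) = \<phi>(ab)\<close>,
  and the involution \<open>\<xi>\<^sup>*(\<phi>) = cnj (\<xi>(\<phi>\<^sup>*))\<close>, where \<open>\<phi>\<^sup>*(a) = cnj (\<phi>(a\<^sup>*))\<close>; C*-algebras are Arens
  regular, so the other Arens product is the same.\<close>

definition arens_mult :: "'h::chilbert_space op set \<Rightarrow>
    'h bifunctional \<Rightarrow> 'h bifunctional \<Rightarrow> 'h bifunctional"
  where "arens_mult T \<xi> \<eta> =
    zero_ext (dual T) (\<lambda>\<phi>. \<xi> (zero_ext T (\<lambda>a. \<eta> (zero_ext T (\<lambda>b. \<phi> (a o\<^sub>L b))))))"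

definition bidual_star :: "'h::chilbert_space op set \<Rightarrow> 'h bifunctional \<Rightarrow> 'h bifunctional"
  where "bidual_star T \<xi> =
    zero_ext (dual T) (\<lambda>\<phi>. cnj (\<xi> (zero_ext T (\<lambda>a. cnj (\<phi> (adj a))))))"

definition bidual_one :: "'h::chilbert_space op set \<Rightarrow> 'h bifunctional"
  where "bidual_one T = embed T id_blinfun"

definition partial_isometry :: "'h::chilbert_space op set \<Rightarrow> 'h bifunctional \<Rightarrow> bool"
  where "partial_isometry T v \<longleftrightarrow>
    v \<in> bidual T \<and> arens_mult T v (arens_mult T (bidual_star T v) v) = v"

definition normal_functionals :: "'h::chilbert_space op set \<Rightarrow> ('h bifunctional \<Rightarrow> complex) set"
  where "normal_functionals T = {f. clinear_on (bidual T) f \<and>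
    continuous_map (weak_star_bidual T) euclidean f \<and> (\<forall>\<xi>. \<xi> \<notin> bidual T \<longrightarrow> f \<xi> = 0)}"

definition normal_ext :: "'h::chilbert_space op set \<Rightarrow>
    'h functional \<Rightarrow> 'h bifunctional \<Rightarrow> complex"
  where "normal_ext T \<phi> = (THE f. f \<in> normal_functionals T \<and> (\<forall>t\<in>T. f (embed T t) = \<phi> t))"

definition positive_functional :: "'h::chilbert_space op set \<Rightarrow>
    ('h bifunctional \<Rightarrow> complex) \<Rightarrow> bool"
  where "positive_functional T f \<longleftrightarrow>
    (\<forall>\<xi>\<in>bidual T. f (arens_mult T (bidual_star T \<xi>) \<xi>) \<in> \<real>\<^sub>\<ge>\<^sub>0)"

definition left_kernel :: "'h::chilbert_space op set \<Rightarrow>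
    ('h bifunctional \<Rightarrow> complex) \<Rightarrow> 'h bifunctional set"
  where "left_kernel T f = {\<xi> \<in> bidual T. f (arens_mult T (bidual_star T \<xi>) \<xi>) = 0}"

definition polar_decomposition :: "'h::chilbert_space op set \<Rightarrow> 'h functional \<Rightarrow>
    'h bifunctional \<Rightarrow> ('h bifunctional \<Rightarrow> complex) \<Rightarrow> bool"
  where "polar_decomposition T \<phi> v p \<longleftrightarrow>
    partial_isometry T v \<and> p \<in> normal_functionals T \<and> positive_functional T p \<and>
    (\<forall>\<xi>\<in>bidual T. normal_ext T \<phi> \<xi> = p (arens_mult T \<xi> v)) \<and>
    {arens_mult T \<xi> (bidual_one T - arens_mult T (bidual_star T v) v) |\<xi>. \<xi> \<in> bidual T}
      = left_kernel T p"

definition abs_normal :: "'h::chilbert_space op set \<Rightarrow>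
    'h functional \<Rightarrow> 'h bifunctional \<Rightarrow> complex"
  where "abs_normal T \<phi> = (THE p. \<exists>v. polar_decomposition T \<phi> v p)"

definition abs_functional :: "'h::chilbert_space op set \<Rightarrow> 'h functional \<Rightarrow> 'h functional"
  where "abs_functional T \<phi> = zero_ext T (\<lambda>t. abs_normal T \<phi> (embed T t))"

definition abs_continuous :: "'h::chilbert_space op set \<Rightarrow> 'h functional \<Rightarrow> 'h functional \<Rightarrow> bool"
  where "abs_continuous T \<phi> \<psi> \<longleftrightarrow>
    left_kernel T (abs_normal T \<psi>) \<subseteq> left_kernel T (abs_normal T \<phi>)"


section \<open>The band of a subalgebra and analytic triples\<close>

definition annihilator :: "'h::chilbert_space op set \<Rightarrow> 'h op set \<Rightarrow> 'h functional set"
  where "annihilator T A = {\<phi> \<in> dual T. \<forall>a\<in>A. \<phi> a = 0}"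

definition norm_closure :: "'h::chilbert_space op set \<Rightarrow> 'h functional set \<Rightarrow> 'h functional set"
  where "norm_closure T S = {\<phi> \<in> dual T. \<forall>\<epsilon>>0. \<exists>\<psi>\<in>S. dual_norm T (\<phi> - \<psi>) < \<epsilon>}"

definition Delta :: "'h::chilbert_space op set \<Rightarrow> 'h op set \<Rightarrow> 'h functional set"
  where "Delta T A =
    norm_closure T (convex hull (abs_functional T ` {\<phi> \<in> annihilator T A. dual_norm T \<phi> = 1}))"

definition AC :: "'h::chilbert_space op set \<Rightarrow> 'h functional set \<Rightarrow> 'h functional set"
  where "AC T D = {\<phi> \<in> dual T. \<exists>\<delta>\<in>D. abs_continuous T \<phi> \<delta>}"

text \<open>Nets are represented by filters on the space of operators: a net corresponds to the filter
  generated by its tails, and every filter arises in this way from a net.\<close>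

definition analytic_triple :: "'h::chilbert_space op set \<Rightarrow> 'h op set \<Rightarrow> bool"
  where "analytic_triple A T \<longleftrightarrow>
    (\<forall>F. (\<exists>M. \<forall>\<^sub>F b in F. b \<in> A \<and> norm b \<le> M) \<longrightarrow>
      (\<forall>\<alpha>\<in>AC T (Delta T A). (\<alpha> \<longlongrightarrow> 0) F) \<longrightarrow> limitin weak_star_BH (\<lambda>b. b) 0 F)"

end

theory Submission
  imports Defs
begin

text \<open>
  Write \<open>\<phi>\<^bsub>h,k\<^esub>\<close> for the functional \<open>t \<mapsto> \<langle>th, k\<rangle>\<close>. If \<open>x \<in> \<Gamma>\<close> then some \<open>y \<noteq> 0\<close> is orthogonal to
  \<open>{a\<^sup>* x}\<close>, i.e. \<open>\<phi>\<^bsub>y,x\<^esub>\<close> annihilates \<open>A\<close>. As \<open>T\<close> contains the rank-one operators, the partial isometry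
  in the polar decomposition of \<open>\<phi>\<^bsub>h,k\<^esub>\<close> lies in \<open>T\<close> itself: it maps \<open>k/\<parallel>k\<parallel>\<close> to \<open>h/\<parallel>h\<parallel>\<close>, and
  \<open>|\<phi>\<^bsub>h,k\<^esub>| = (\<parallel>h\<parallel>/\<parallel>k\<parallel>) \<phi>\<^bsub>k,k\<^esub>\<close>. So the vector state of every normalized nonzero \<open>x \<in> \<Gamma>\<close>, and by
  density of every unit vector, lies in \<open>\<Delta>\<close>; the vector state of \<open>k/\<parallel>k\<parallel>\<close> dominates \<open>\<phi>\<^bsub>h,k\<^esub>\<close>.
  Analyticity follows because on bounded sets the weak-* topology is given by the functionals \<open>\<phi>\<^bsub>h,k\<^esub>\<close>.

  The only input about the bidual is elementary: each \<open>\<xi>\<close> in it acts on the Hilbert space through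
  \<open>\<langle>\<xi>h, k\<rangle> = \<xi>(\<phi>\<^bsub>h,k\<^esub>)\<close> by the Riesz theorem, and a weak-* continuous functional on it is an evaluation.
\<close>

section \<open>Geometry of complex Hilbert spaces\<close>

lemma scaleC_zero_left [simp]: "0 *\<^sub>C x = (0::'a::complex_vector)"
  using scaleR_scaleC[of 0 x] by simp

lemma scaleC_zero_right [simp]: "c *\<^sub>C 0 = (0::'a::complex_vector)"
  using scaleC_add_right[of c 0 "0::'a"] by simp

lemma scaleC_minus_one: "(-1) *\<^sub>C x = - (x::'a::complex_vector)"
  using scaleR_scaleC[of "-1" x] by simp

lemma cinner_zero_left [simp]: "cinner 0 y = 0"
  using cinner_add_left[of 0 0 y] by simp

lemma cinner_minus_left: "cinner (- x) y = - cinner x y"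
  using cinner_scaleC_left[of "-1" x y] by (simp add: scaleC_minus_one)

lemma cinner_diff_left: "cinner (x - y) z = cinner x z - cinner y z"
  using cinner_add_left[of x "- y" z] by (simp add: cinner_minus_left)

lemma cinner_scaleR_left: "cinner (r *\<^sub>R x) y = of_real r * cinner x y"
  by (simp add: scaleR_scaleC cinner_scaleC_left)

lemma cinner_zero_right [simp]: "cinner x 0 = 0"
  using cinner_commute[of x 0] by simp

lemma cinner_add_right: "cinner x (y + z) = cinner x y + cinner x z"
  unfolding cinner_commute[of x "y + z"] cinner_commute[of x y] cinner_commute[of x z]
  by (simp add: cinner_add_left)

lemma cinner_scaleC_right: "cinner x (a *\<^sub>C y) = cnj a * cinner x y"
  unfolding cinner_commute[of x "a *\<^sub>C y"] cinner_commute[of x y]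
  by (simp add: cinner_scaleC_left)

lemma cinner_diff_right: "cinner x (y - z) = cinner x y - cinner x z"
  unfolding cinner_commute[of x "y - z"] cinner_commute[of x y] cinner_commute[of x z]
  by (simp add: cinner_diff_left)

lemma cinner_scaleR_right: "cinner x (r *\<^sub>R y) = of_real r * cinner x y"
  by (simp add: scaleR_scaleC cinner_scaleC_right)

lemma cinner_self_eq_0_iff [simp]: "cinner x x = 0 \<longleftrightarrow> x = 0"
  by (simp add: cinner_self)

lemma norm_add_square:
  fixes x y :: "'a::chilbert_space"
  shows "(norm (x + y))\<^sup>2 = (norm x)\<^sup>2 + 2 * Re (cinner x y) + (norm y)\<^sup>2"
proof -
  have "Re (cinner (x + y) (x + y)) = Re (cinner x x) + 2 * Re (cinner x y) + Re (cinner y y)"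
    using cinner_commute[of y x] by (simp add: cinner_add_left cinner_add_right)
  then show ?thesis
    by (simp add: cinner_self)
qed

lemma Cauchy_Schwarz_cinner:
  fixes x y :: "'a::chilbert_space"
  shows "cmod (cinner x y) \<le> norm x * norm y"
proof (cases "y = 0")
  case False
  define l where "l = - cinner x y / of_real ((norm y)\<^sup>2)"
  have ny: "norm y > 0"
    using False by simp
  have "0 \<le> (norm (x + l *\<^sub>C y))\<^sup>2"
    by simp
  also have "\<dots> = (norm x)\<^sup>2 + 2 * Re (cnj l * cinner x y) + (cmod l * norm y)\<^sup>2"
    by (simp add: norm_add_square cinner_scaleC_right norm_scaleC)
  also have "cnj l * cinner x y = - of_real ((cmod (cinner x y))\<^sup>2 / (norm y)\<^sup>2)"
    using ny unfolding l_def of_real_divide complex_norm_square by (simp add: field_simps)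
  also have "cmod l = cmod (cinner x y) / (norm y)\<^sup>2"
    unfolding l_def by (simp add: norm_divide norm_power)
  also have "(\<dots> * norm y)\<^sup>2 = (cmod (cinner x y))\<^sup>2 / (norm y)\<^sup>2"
    using ny by (simp add: field_simps power2_eq_square)
  finally have "(cmod (cinner x y))\<^sup>2 / (norm y)\<^sup>2 \<le> (norm x)\<^sup>2"
    by (simp del: of_real_divide of_real_power)
  then have "(cmod (cinner x y))\<^sup>2 \<le> (norm x * norm y)\<^sup>2"
    using ny by (simp add: divide_le_eq power_mult_distrib)
  then show ?thesis
    by (rule power2_le_imp_le) simp
qed simp

lemma bounded_linear_cinner_left: "bounded_linear (\<lambda>x::'a::chilbert_space. cinner x y)"
  by (rule bounded_linear_intro[where K = "norm y"])
    (simp_all add: cinner_add_left cinner_scaleR_left Cauchy_Schwarz_cinner scaleR_conv_of_real)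

lemma bounded_linear_scaleC_left: "bounded_linear (\<lambda>c. c *\<^sub>C (x::'a::chilbert_space))"
  by (rule bounded_linear_intro[where K = "norm x"])
    (simp_all add: scaleC_add_left scaleR_scaleC scaleC_scaleC norm_scaleC scaleC_complex_def)

lemma cinner_ext:
  fixes y z :: "'a::chilbert_space"
  assumes "\<And>x. cinner x y = cinner x z"
  shows "y = z"
  using assms[of "y - z"] cinner_self_eq_0_iff[of "y - z"] by (simp add: cinner_diff_right)

text \<open>For small \<open>s > 0\<close> the choice \<open>l = - s * cnj c\<close> makes the
  linear term negative of order \<open>s\<close>, while the quadratic term is only of order
  \<open>s\<close> squared. This first-variation argument serves for orthogonal projections and
  again for positive functionals.\<close>

lemma quadratic_nonneg_imp_zero:
  fixes c :: complex and d :: real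
  assumes nonneg: "\<And>l. 0 \<le> 2 * Re (l * c) + (cmod l)\<^sup>2 * d" and "0 \<le> d"
  shows "c = 0"
proof (rule ccontr)
  assume "c \<noteq> 0"
  \<comment> \<open>The shift by 1 keeps \<open>s\<close> well defined when \<open>d = 0\<close> and
    gives \<open>s * d < 1\<close>.\<close>
  define s where "s = 1 / (d + 1)"
  have s: "s > 0" "s * d < 1"
    using \<open>0 \<le> d\<close> by (simp_all add: s_def field_simps)
  have "Re (- of_real s * cnj c * c) = - s * (cmod c)\<^sup>2"
    unfolding cmod_power2 by (simp add: power2_eq_square algebra_simps)
  then have "0 \<le> - 2 * s * (cmod c)\<^sup>2 + (s * cmod c)\<^sup>2 * d"
    using nonneg[of "- of_real s * cnj c"] s by (simp add: norm_mult power_mult_distrib)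
  also have "\<dots> = s * (cmod c)\<^sup>2 * (s * d - 2)"
    by (simp add: algebra_simps power2_eq_square)
  also have "\<dots> < 0"
    using s \<open>c \<noteq> 0\<close> by (intro mult_pos_neg) auto
  finally show False
    by simp
qed

section \<open>Orthogonal projection and Riesz representation\<close>

lemma csubspace_diff: "csubspace X \<Longrightarrow> x \<in> X \<Longrightarrow> y \<in> X \<Longrightarrow> x - y \<in> X"
  unfolding csubspace_def by (metis scaleC_minus_one diff_conv_add_uminus)

text \<open>A sequence in \<open>M\<close> minimizing the distance to \<open>x\<close> is Cauchy by
  the parallelogram law; its limit attains the distance, and minimality forces orthogonality of
  \<open>x - m\<close> to \<open>M\<close>.\<close>

lemma orthogonal_projection_exists:
  fixes x :: "'a::chilbert_space"
  assumes M: "csubspace M" "closed M"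
  shows "\<exists>m\<in>M. \<forall>n\<in>M. cinner n (x - m) = 0"
proof -
  define d where "d = infdist x M"
  have M0: "0 \<in> M" and Madd: "\<And>a b. a \<in> M \<Longrightarrow> b \<in> M \<Longrightarrow> a + b \<in> M"
    and Mscale: "\<And>c a. a \<in> M \<Longrightarrow> c *\<^sub>C a \<in> M"
    using M by (auto simp: csubspace_def)
  have d0: "0 \<le> d"
    by (simp add: d_def infdist_nonneg)
  have d_le: "d \<le> norm (x - a)" if "a \<in> M" for a
    using infdist_le[OF that, of x] by (simp add: d_def dist_norm)
  have "\<exists>a\<in>M. norm (x - a) < d + e" if "e > 0" for e
    using cInf_lessD[of "(\<lambda>a. dist x a) ` M" "d + e"] M0 that
    by (auto simp: d_def infdist_def dist_norm)
  then have "\<forall>i. \<exists>a. a \<in> M \<and> norm (x - a) < d + 1 / Suc i"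
    by (metis zero_less_divide_1_iff of_nat_0_less_iff zero_less_Suc)
  then obtain a where aM: "\<And>i. a i \<in> M" and a: "\<And>i. norm (x - a i) < d + 1 / Suc i"
    by metis
  have a_lim: "(\<lambda>i. norm (x - a i)) \<longlonglongrightarrow> d"
  proof (rule tendsto_sandwich[of "\<lambda>_. d" _ _ "\<lambda>i. d + 1 / Suc i"])
    show "(\<lambda>i. d + 1 / real (Suc i)) \<longlonglongrightarrow> d"
      using tendsto_add[OF tendsto_const LIMSEQ_inverse_real_of_nat, of d]
      by (simp add: inverse_eq_divide)
  qed (use d_le aM a in \<open>auto intro!: always_eventually less_imp_le\<close>)
  \<comment> \<open>The midpoint of \<open>a i\<close> and \<open>a j\<close> lies in
    \<open>M\<close>, hence has distance at least \<open>d\<close> from \<open>x\<close>; the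
    parallelogram law for \<open>x - a i\<close> and \<open>x - a j\<close> turns this into an upper
    bound for their difference.\<close>
  have par: "(norm (a i - a j))\<^sup>2 \<le> 2 * (norm (x - a i))\<^sup>2 + 2 * (norm (x - a j))\<^sup>2 - 4 * d\<^sup>2"
    for i j
  proof -
    let ?u = "x - a i" and ?v = "x - a j"
    let ?m = "complex_of_real (1/2) *\<^sub>C (a i + a j)"
    have "?u + ?v = 2 *\<^sub>R (x - ?m)"
      by (simp add: scaleR_scaleC[symmetric] scaleR_right_diff_distrib scaleR_2 del: of_real_divide)
    then have sum: "(norm (?u + ?v))\<^sup>2 = 4 * (norm (x - ?m))\<^sup>2"
      by (simp add: power_mult_distrib)
    have "d \<le> norm (x - ?m)"
      using aM by (intro d_le Mscale Madd)
    then have "d\<^sup>2 \<le> (norm (x - ?m))\<^sup>2"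
      using d0 by (simp add: power_mono)
    moreover have "(norm (?u - ?v))\<^sup>2 = 2 * (norm ?u)\<^sup>2 + 2 * (norm ?v)\<^sup>2 - (norm (?u + ?v))\<^sup>2"
      using norm_add_square[of ?u ?v] norm_add_square[of ?u "- ?v"] cinner_scaleC_right[of ?u "-1" ?v]
      by (simp add: scaleC_minus_one norm_minus_commute[of "a j" x])
    moreover have "norm (a i - a j) = norm (?u - ?v)"
      by (simp add: norm_minus_commute)
    ultimately show ?thesis
      using sum by simp
  qed
  have "Cauchy a"
  proof (rule metric_CauchyI)
    fix e :: real
    assume e: "e > 0"
    have "(\<lambda>i. (norm (x - a i))\<^sup>2) \<longlonglongrightarrow> d\<^sup>2"
      by (intro tendsto_power a_lim)
    then have "\<forall>\<^sub>F i in sequentially. (norm (x - a i))\<^sup>2 < d\<^sup>2 + e\<^sup>2 / 4"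
      using e by (intro order_tendstoD) auto
    then obtain N where N: "\<And>i. i \<ge> N \<Longrightarrow> (norm (x - a i))\<^sup>2 < d\<^sup>2 + e\<^sup>2 / 4"
      by (auto simp: eventually_sequentially)
    have "dist (a i) (a j) < e" if "i \<ge> N" "j \<ge> N" for i j
    proof (rule power2_less_imp_less)
      show "(dist (a i) (a j))\<^sup>2 < e\<^sup>2"
        using par[of i j] N[OF that(1)] N[OF that(2)] by (simp add: dist_norm)
    qed (use e in simp)
    then show "\<exists>N. \<forall>i\<ge>N. \<forall>j\<ge>N. dist (a i) (a j) < e"
      by blast
  qed
  then obtain m where m: "a \<longlonglongrightarrow> m"
    using Cauchy_convergent convergent_def by blast
  have mM: "m \<in> M"
    using closed_sequentially[OF M(2) _ m] aM by auto
  have "(\<lambda>i. norm (x - a i)) \<longlonglongrightarrow> norm (x - m)"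
    by (intro tendsto_intros m)
  then have md: "norm (x - m) = d"
    using a_lim LIMSEQ_unique by blast
  \<comment> \<open>Moving \<open>m\<close> to \<open>m - l *\<^sub>C n\<close> stays in
    \<open>M\<close> and so cannot decrease the distance; this holds for every complex
    \<open>l\<close>.\<close>
  have "cinner n (x - m) = 0" if n: "n \<in> M" for n
  proof (rule quadratic_nonneg_imp_zero)
    fix l :: complex
    have "m - l *\<^sub>C n \<in> M"
      by (intro csubspace_diff M mM Mscale n)
    then have "d\<^sup>2 \<le> (norm (l *\<^sub>C n + (x - m)))\<^sup>2"
      using d_le[of "m - l *\<^sub>C n"] d0 by (intro power_mono) (auto simp: algebra_simps)
    then show "0 \<le> 2 * Re (l * cinner n (x - m)) + (cmod l)\<^sup>2 * (norm n)\<^sup>2"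
      by (simp add: norm_add_square cinner_scaleC_left norm_scaleC md power_mult_distrib)
  qed simp
  then show ?thesis
    using mM by blast
qed

lemma exists_orthogonal_vector:
  fixes M :: "'a::chilbert_space set"
  assumes "csubspace M" "closed M" "M \<noteq> UNIV"
  shows "\<exists>y. y \<noteq> 0 \<and> (\<forall>m\<in>M. cinner m y = 0)"
proof -
  obtain x where "x \<notin> M"
    using assms(3) by blast
  then show ?thesis
    using orthogonal_projection_exists[OF assms(1,2), of x]
    by (metis eq_iff_diff_eq_0)
qed

text \<open>A nonzero \<open>w\<close> orthogonal to the closed kernel of \<open>f\<close> has
  \<open>f w\<close> nonzero, since otherwise \<open>w\<close> would be orthogonal to itself. As
  \<open>x - (f x / f w) *\<^sub>C w\<close> lies in the kernel, pairing it with \<open>w\<close>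
  expresses \<open>f x\<close> through \<open>cinner x w\<close>.\<close>

lemma Riesz_representation:
  fixes f :: "'a::chilbert_space \<Rightarrow> complex"
  assumes add: "\<And>x y. f (x + y) = f x + f y" and scale: "\<And>c x. f (c *\<^sub>C x) = c * f x"
    and bound: "\<And>x. cmod (f x) \<le> K * norm x"
  shows "\<exists>y. \<forall>x. f x = cinner x y"
proof (cases "\<forall>x. f x = 0")
  case True
  then show ?thesis
    by (intro exI[of _ 0]) simp
next
  case False
  have "bounded_linear f"
    by (rule bounded_linear_intro[where K = K])
      (use bound in \<open>auto simp: add scale scaleR_scaleC scaleC_complex_def mult.commute\<close>)
  then have "closed {x. f x = 0}"
    by (intro closed_Collect_eq continuous_on_const linear_continuous_on)
  moreover have "csubspace {x. f x = 0}"
    using scale[of 0 0] by (auto simp: csubspace_def add scale)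
  ultimately obtain w where w: "w \<noteq> 0" "\<And>m. f m = 0 \<Longrightarrow> cinner m w = 0"
    using exists_orthogonal_vector[of "{x. f x = 0}"] False by auto
  have "f w \<noteq> 0"
    using w cinner_self_eq_0_iff[of w] by blast
  have "f x = cinner x ((cnj (f w) / cinner w w) *\<^sub>C w)" for x
  proof -
    have "f (x - (f x / f w) *\<^sub>C w) = 0"
      using add[of "x - (f x / f w) *\<^sub>C w" "(f x / f w) *\<^sub>C w"] \<open>f w \<noteq> 0\<close> by (simp add: scale)
    then have "cinner x w = f x / f w * cinner w w"
      using w(2) by (force simp: cinner_diff_left cinner_scaleC_left)
    then show ?thesis
      using \<open>f w \<noteq> 0\<close> w(1) by (simp add: cinner_scaleC_right cinner_self)
  qed
  then show ?thesis
    by blast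
qed


section \<open>Adjoints and rank-one operators\<close>

lemma scaleC_blinfun_apply [simp]: "blinfun_apply (c *\<^sub>C t) x = c *\<^sub>C blinfun_apply t x"
  by (simp add: scaleC_blinfun.rep_eq)

lemma BH_scaleC: "t \<in> BH \<Longrightarrow> blinfun_apply t (c *\<^sub>C x) = c *\<^sub>C blinfun_apply t x"
  by (simp add: BH_def)

lemma adj_eqI:
  assumes "\<And>x y. cinner (blinfun_apply t x) y = cinner x (blinfun_apply s y)"
  shows "adj t = s"
  unfolding adj_def
proof (rule the_equality)
  fix r
  assume "\<forall>x y. cinner (blinfun_apply t x) y = cinner x (blinfun_apply r y)"
  then show "r = s"
    using assms by - (rule blinfun_eqI, rule cinner_ext, simp)
qed (use assms in blast)

text \<open>The Riesz theorem, applied for each \<open>y\<close> to the functional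
  \<open>x \<mapsto> \<langle>tx, y\<rangle>\<close>, supplies a vector \<open>s y\<close>; these
  vectors depend linearly and boundedly on \<open>y\<close>, so the description defining
  \<open>adj\<close> is satisfied.\<close>

lemma cinner_adj:
  assumes t: "t \<in> BH"
  shows "cinner (blinfun_apply t x) y = cinner x (blinfun_apply (adj t) y)"
proof -
  have "\<exists>z. \<forall>x. cinner (blinfun_apply t x) y = cinner x z" for y
  proof (rule Riesz_representation[where K = "norm t * norm y"])
    show "cmod (cinner (blinfun_apply t x) y) \<le> norm t * norm y * norm x" for x
    proof -
      have "cmod (cinner (blinfun_apply t x) y) \<le> norm (blinfun_apply t x) * norm y"
        by (rule Cauchy_Schwarz_cinner)
      also have "\<dots> \<le> (norm t * norm x) * norm y"
        by (intro mult_right_mono norm_blinfun) auto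
      finally show ?thesis
        by (simp add: mult_ac)
    qed
  qed (simp_all add: blinfun.add_right cinner_add_left BH_scaleC[OF t] cinner_scaleC_left)
  then obtain s where s: "\<And>x y. cinner (blinfun_apply t x) y = cinner x (s y)"
    by metis
  have "bounded_linear s"
  proof (rule bounded_linear_intro[where K = "norm t"])
    show "s (x + y) = s x + s y" for x y
      by (rule cinner_ext) (simp add: cinner_add_right flip: s)
    show "s (r *\<^sub>R x) = r *\<^sub>R s x" for r x
      by (rule cinner_ext) (simp add: cinner_scaleR_right flip: s)
    show "norm (s y) \<le> norm y * norm t" for y
    proof (cases "s y = 0")
      case False
      \<comment> \<open>Testing the defining identity of \<open>s y\<close> at the vector
        \<open>s y\<close> itself bounds its norm.\<close>
      have "(norm (s y))\<^sup>2 = cmod (cinner (blinfun_apply t (s y)) y)"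
        by (simp add: s cinner_self norm_power)
      also have "\<dots> \<le> norm (blinfun_apply t (s y)) * norm y"
        by (rule Cauchy_Schwarz_cinner)
      also have "\<dots> \<le> (norm t * norm (s y)) * norm y"
        by (intro mult_right_mono norm_blinfun) auto
      finally show ?thesis
        using False by (simp add: power2_eq_square mult_ac)
    qed simp
  qed
  then have "adj t = Blinfun s"
    by (intro adj_eqI) (simp add: s bounded_linear_Blinfun_apply)
  then show ?thesis
    using \<open>bounded_linear s\<close> by (simp add: s bounded_linear_Blinfun_apply)
qed

lemma cinner_adj_left:
  assumes "t \<in> BH"
  shows "cinner (blinfun_apply (adj t) x) y = cinner x (blinfun_apply t y)"
  unfolding cinner_commute[of "blinfun_apply (adj t) x"] cinner_commute[of x] cinner_adj[OF assms] ..

lemma adj_add: "s \<in> BH \<Longrightarrow> t \<in> BH \<Longrightarrow> adj (s + t) = adj s + adj t"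
  by (rule adj_eqI) (simp add: blinfun.add_left cinner_add_left cinner_add_right cinner_adj)

lemma adj_scaleC: "t \<in> BH \<Longrightarrow> adj (c *\<^sub>C t) = cnj c *\<^sub>C adj t"
  by (rule adj_eqI) (simp add: cinner_scaleC_left cinner_scaleC_right cinner_adj)

lemma adj_id: "adj id_blinfun = id_blinfun"
  by (rule adj_eqI) simp

lemma norm_adj_le:
  assumes t: "t \<in> BH"
  shows "norm (adj t) \<le> norm t"
proof (rule norm_blinfun_bound)
  fix y
  let ?s = "blinfun_apply (adj t) y"
  show "norm ?s \<le> norm t * norm y"
  proof (cases "?s = 0")
    case False
    have "(norm ?s)\<^sup>2 = cmod (cinner (blinfun_apply t ?s) y)"
      by (simp add: cinner_adj[OF t] cinner_self norm_power)
    also have "\<dots> \<le> norm (blinfun_apply t ?s) * norm y"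
      by (rule Cauchy_Schwarz_cinner)
    also have "\<dots> \<le> (norm t * norm ?s) * norm y"
      by (intro mult_right_mono norm_blinfun) auto
    finally show ?thesis
      using False by (simp add: power2_eq_square mult_ac)
  qed simp
qed simp

section \<open>Rank-one operators\<close>

definition rank_one :: "'h::chilbert_space \<Rightarrow> 'h \<Rightarrow> 'h op"
  where "rank_one x y = Blinfun (\<lambda>z. cinner z y *\<^sub>C x)"

lemma rank_one_apply [simp]: "blinfun_apply (rank_one x y) z = cinner z y *\<^sub>C x"
proof -
  have "bounded_linear (\<lambda>z. cinner z y *\<^sub>C x)"
    by (rule bounded_linear_compose[OF bounded_linear_scaleC_left bounded_linear_cinner_left])
  then show ?thesis
    by (simp add: rank_one_def bounded_linear_Blinfun_apply)
qed

lemma norm_rank_one_le: "norm (rank_one x y) \<le> norm x * norm y"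
proof (rule norm_blinfun_bound)
  show "norm (blinfun_apply (rank_one x y) z) \<le> norm x * norm y * norm z" for z
    using mult_right_mono[OF Cauchy_Schwarz_cinner[of z y] norm_ge_zero[of x]]
    by (simp add: norm_scaleC mult_ac)
qed simp

lemma rank_one_in_BH: "rank_one x y \<in> BH"
  by (simp add: BH_def cinner_scaleC_left scaleC_scaleC)

lemma compact_closure_subset:
  fixes K :: "'a::t2_space set"
  assumes "compact K" "S \<subseteq> K"
  shows "compact (closure S)"
proof -
  have "closure S \<subseteq> K"
    by (rule closure_minimal[OF assms(2) compact_imp_closed[OF assms(1)]])
  then have "K \<inter> closure S = closure S"
    by blast
  then show ?thesis
    using compact_Int_closed[OF assms(1) closed_closure, of S] by simp
qed

text \<open>The image of the unit ball lies in the set of multiples \<open>c *\<^sub>C x\<close>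
  with \<open>cmod c \<le> norm y\<close>, the continuous image of a compact disc.\<close>

lemma rank_one_compact: "rank_one x y \<in> compact_operators"
proof -
  have "compact ((\<lambda>c. c *\<^sub>C x) ` cball 0 (norm y))"
    by (intro compact_continuous_image linear_continuous_on bounded_linear_scaleC_left compact_cball)
  moreover have "blinfun_apply (rank_one x y) ` cball 0 1 \<subseteq> (\<lambda>c. c *\<^sub>C x) ` cball 0 (norm y)"
  proof safe
    fix z :: 'a
    assume "z \<in> cball 0 1"
    then have "norm z * norm y \<le> 1 * norm y"
      by (intro mult_right_mono) auto
    then have "cinner z y \<in> cball 0 (norm y)"
      using Cauchy_Schwarz_cinner[of z y] by simp
    then show "blinfun_apply (rank_one x y) z \<in> (\<lambda>c. c *\<^sub>C x) ` cball 0 (norm y)"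
      by simp
  qed
  ultimately have "compact (closure (blinfun_apply (rank_one x y) ` cball 0 1))"
    by (rule compact_closure_subset)
  then show ?thesis
    by (simp add: compact_operators_def rank_one_in_BH)
qed

lemma adj_rank_one: "adj (rank_one x y) = rank_one y x"
proof (rule adj_eqI)
  fix u v
  show "cinner (blinfun_apply (rank_one x y) u) v = cinner u (blinfun_apply (rank_one y x) v)"
    using cinner_commute[of x v] by (simp add: cinner_scaleC_left cinner_scaleC_right)
qed

lemma compose_rank_one: "t \<in> BH \<Longrightarrow> t o\<^sub>L rank_one x y = rank_one (blinfun_apply t x) y"
  by (rule blinfun_eqI) (simp add: BH_scaleC)

lemma rank_one_add: "rank_one (x + x') y = rank_one x y + rank_one x' y"
  by (rule blinfun_eqI) (simp add: scaleC_add_right blinfun.add_left)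

lemma rank_one_scaleC: "rank_one (c *\<^sub>C x) y = c *\<^sub>C rank_one x y"
  by (rule blinfun_eqI) (simp add: scaleC_scaleC mult.commute)


section \<open>Weak topologies\<close>

lemma topspace_weak_topology_subset: "topspace (weak_topology X \<F>) \<subseteq> X"
  by (auto simp: weak_topology_def)

lemma topspace_weak_topology:
  assumes "\<F> \<noteq> {}"
  shows "topspace (weak_topology X \<F>) = X"
proof
  obtain f where "f \<in> \<F>"
    using assms by blast
  then have "{x \<in> X. f x \<in> UNIV} \<in> {{x \<in> X. f x \<in> U} |f U. f \<in> \<F> \<and> open U}"
    using open_UNIV by blast
  then show "X \<subseteq> topspace (weak_topology X \<F>)"
    by (auto simp: weak_topology_def)
qed (rule topspace_weak_topology_subset)

text \<open>Induction over the generation of the topology from its subbasis: intersections merge the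
  finite sets of functionals and take the smaller radius. It is used twice, for convergence of nets
  in B(H) and for identifying the weak-* continuous functionals on the bidual.\<close>

lemma weak_topology_basic_neighbourhood:
  assumes "openin (weak_topology X \<F>) V" and "x0 \<in> V"
  shows "\<exists>S e. finite S \<and> S \<subseteq> \<F> \<and> e > 0 \<and>
    (\<forall>x\<in>X. (\<forall>f\<in>S. cmod (f x - f x0) < e) \<longrightarrow> x \<in> V)"
proof -
  have "generate_topology_on {{x \<in> X. f x \<in> U} |f U. f \<in> \<F> \<and> open U} V"
    using assms(1) by (simp add: weak_topology_def openin_topology_generated_by_iff)
  then show ?thesis
    using assms(2)
  proof (induction arbitrary: x0)
    case Empty
    then show ?case
      by simp
  next
    case (Int a b)
    from Int.IH(1)[of x0] Int.prems obtain S e where S: "finite S" "S \<subseteq> \<F>" "e > 0"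
      "\<forall>x\<in>X. (\<forall>f\<in>S. cmod (f x - f x0) < e) \<longrightarrow> x \<in> a"
      by auto
    from Int.IH(2)[of x0] Int.prems obtain S' e' where S': "finite S'" "S' \<subseteq> \<F>" "e' > 0"
      "\<forall>x\<in>X. (\<forall>f\<in>S'. cmod (f x - f x0) < e') \<longrightarrow> x \<in> b"
      by auto
    show ?case
      by (rule exI[of _ "S \<union> S'"], rule exI[of _ "min e e'"]) (use S S' in auto)
  next
    case (UN K)
    then obtain k where k: "k \<in> K" "x0 \<in> k"
      by blast
    from UN.IH[OF k] obtain S e where "finite S" "S \<subseteq> \<F>" "e > 0"
      "\<forall>x\<in>X. (\<forall>f\<in>S. cmod (f x - f x0) < e) \<longrightarrow> x \<in> k"
      by auto
    then show ?case
      using k(1) by (intro exI[of _ S] exI[of _ e]) auto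
  next
    case (Basis s)
    then obtain f U where f: "f \<in> \<F>" "open U" and s: "s = {x \<in> X. f x \<in> U}"
      by auto
    then obtain e where "e > 0" "\<And>z. dist z (f x0) < e \<Longrightarrow> z \<in> U"
      using Basis.prems by (auto simp: open_dist)
    then show ?case
      using f s by (intro exI[of _ "{f}"] exI[of _ e]) (auto simp: dist_norm)
  qed
qed

lemma limitin_weak_topology:
  assumes x0: "x0 \<in> X" and "\<F> \<noteq> {}" and X: "\<forall>\<^sub>F b in F. b \<in> X"
    and lim: "\<And>f. f \<in> \<F> \<Longrightarrow> (f \<longlongrightarrow> f x0) F"
  shows "limitin (weak_topology X \<F>) (\<lambda>b. b) x0 F"
  unfolding limitin_def
proof (intro conjI allI impI)
  show "x0 \<in> topspace (weak_topology X \<F>)"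
    using assms by (simp add: topspace_weak_topology)
  fix V
  assume "openin (weak_topology X \<F>) V \<and> x0 \<in> V"
  then obtain S e where S: "finite S" "S \<subseteq> \<F>" "e > 0"
    "\<forall>x\<in>X. (\<forall>f\<in>S. cmod (f x - f x0) < e) \<longrightarrow> x \<in> V"
    using weak_topology_basic_neighbourhood[of X \<F> V x0] by auto
  have "\<forall>\<^sub>F b in F. cmod (f b - f x0) < e" if "f \<in> S" for f
    using tendstoD[OF lim S(3)] that S(2) by (auto simp: dist_norm)
  then have "\<forall>\<^sub>F b in F. \<forall>f\<in>S. cmod (f b - f x0) < e"
    using S(1) by (simp add: eventually_ball_finite)
  with X show "\<forall>\<^sub>F b in F. b \<in> V"
    by eventually_elim (use S(4) in blast)
qed

text \<open>Induction on \<open>S\<close>: the hypothesis is applied on the kernel \<open>Y\<close>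
  of one functional \<open>g j\<close>, and the result is corrected along a vector \<open>e\<close>
  with \<open>g j e = 1\<close>. The space varies in the induction because \<open>Y\<close> replaces
  \<open>X\<close>.\<close>

lemma clinear_on_sum_of_common_kernel:
  fixes f :: "'a::complex_vector \<Rightarrow> complex" and g :: "'i \<Rightarrow> 'a \<Rightarrow> complex"
  assumes "finite S" "csubspace X" "clinear_on X f" "\<And>i. i \<in> S \<Longrightarrow> clinear_on X (g i)"
    and "\<And>x. x \<in> X \<Longrightarrow> (\<And>i. i \<in> S \<Longrightarrow> g i x = 0) \<Longrightarrow> f x = 0"
  shows "\<exists>c. \<forall>x\<in>X. f x = (\<Sum>i\<in>S. c i * g i x)"
  using assms
proof (induction S arbitrary: X rule: finite_induct)
  case empty
  then show ?case
    by simp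
next
  case (insert j S)
  define Y where "Y = {x \<in> X. g j x = 0}"
  have gj: "clinear_on X (g j)"
    using insert.prems by simp
  have g0: "g j 0 = 0"
    using gj insert.prems(1) unfolding clinear_on_def csubspace_def
    by (metis scaleC_zero_left mult_zero_left)
  have Y: "csubspace Y"
    using insert.prems(1) gj g0 by (auto simp: Y_def csubspace_def clinear_on_def)
  have "\<exists>c. \<forall>x\<in>Y. f x = (\<Sum>i\<in>S. c i * g i x)"
  proof (rule insert.IH[OF Y])
    show "clinear_on Y f" and "\<And>i. i \<in> S \<Longrightarrow> clinear_on Y (g i)"
      using insert.prems by (auto simp: Y_def clinear_on_def)
    show "f x = 0" if "x \<in> Y" "\<And>i. i \<in> S \<Longrightarrow> g i x = 0" for x
      using that insert.prems(4)[of x] by (auto simp: Y_def)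
  qed
  then obtain c where c: "\<And>x. x \<in> Y \<Longrightarrow> f x = (\<Sum>i\<in>S. c i * g i x)"
    by blast
  show ?case
  proof (cases "\<forall>x\<in>X. g j x = 0")
    case True
    then have "f x = (\<Sum>i\<in>insert j S. c i * g i x)" if "x \<in> X" for x
      using c[of x] that insert.hyps by (simp add: Y_def)
    then show ?thesis
      by blast
  next
    case False
    then obtain e' where e': "e' \<in> X" "g j e' \<noteq> 0"
      by blast
    define e where "e = (1 / g j e') *\<^sub>C e'"
    have e: "e \<in> X" "g j e = 1"
      using e' gj insert.prems(1) by (auto simp: e_def clinear_on_def csubspace_def)
    \<comment> \<open>The coefficient of \<open>g j\<close> is the defect at \<open>e\<close> of the
      formula already known on \<open>Y\<close>.\<close>
    define a where "a = f e - (\<Sum>i\<in>S. c i * g i e)"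
    have "f x = (\<Sum>i\<in>insert j S. (c(j := a)) i * g i x)" if x: "x \<in> X" for x
    proof -
      \<comment> \<open>This is the projection of \<open>x\<close> into \<open>Y\<close> along
        \<open>e\<close>.\<close>
      define y where "y = x + (- g j x) *\<^sub>C e"
      have mem: "(- g j x) *\<^sub>C e \<in> X"
        using insert.prems(1) e by (auto simp: csubspace_def)
      then have lin: "h y = h x - g j x * h e" if "clinear_on X h" for h
        using that x e by (simp add: y_def clinear_on_def)
      have "y \<in> Y"
        using insert.prems(1) x mem lin[OF gj] e by (auto simp: Y_def csubspace_def y_def)
      have "f x = f y + g j x * f e"
        using lin[OF insert.prems(2)] by simp
      also have "f y = (\<Sum>i\<in>S. c i * (g i x - g j x * g i e))"
        using c[OF \<open>y \<in> Y\<close>] lin insert.prems(3) by simp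
      also have "\<dots> = (\<Sum>i\<in>S. c i * g i x) - g j x * (\<Sum>i\<in>S. c i * g i e)"
        by (simp add: algebra_simps sum_subtractf sum_distrib_left)
      also have "\<dots> + g j x * f e = (\<Sum>i\<in>S. c i * g i x) + a * g j x"
        by (simp add: a_def algebra_simps)
      also have "(\<Sum>i\<in>S. c i * g i x) = (\<Sum>i\<in>S. (c(j := a)) i * g i x)"
        using insert.hyps by (intro sum.cong) auto
      finally show ?thesis
        using insert.hyps by simp
    qed
    then show ?thesis
      by blast
  qed
qed


section \<open>Functionals on subspaces\<close>

lemma zero_ext_in [simp]: "x \<in> X \<Longrightarrow> zero_ext X f x = f x"
  by (simp add: zero_ext_def)

lemma zero_ext_notin [simp]: "x \<notin> X \<Longrightarrow> zero_ext X f x = 0"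
  by (simp add: zero_ext_def)

lemma zero_ext_add: "zero_ext X (\<lambda>x. f x + g x) = zero_ext X f + zero_ext X g"
  by (auto simp: zero_ext_def)

lemma zero_ext_scaleC: "zero_ext X (\<lambda>x. c * f x) = c *\<^sub>C zero_ext X f"
  by (auto simp: zero_ext_def scaleC_fun_def scaleC_complex_def)

lemma scaleC_fun_apply [simp]: "(c *\<^sub>C f) x = c * (f x :: complex)"
  by (simp add: scaleC_fun_def scaleC_complex_def)

lemma zero_ext_eqI:
  assumes "\<And>x. x \<in> X \<Longrightarrow> f x = g x"
  shows "zero_ext X f = zero_ext X g"
  using assms by (auto simp: zero_ext_def)

lemma cdual_add: "f \<in> cdual X N \<Longrightarrow> x \<in> X \<Longrightarrow> y \<in> X \<Longrightarrow> f (x + y) = f x + f y"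
  by (simp add: cdual_def clinear_on_def)

lemma cdual_scale: "f \<in> cdual X N \<Longrightarrow> x \<in> X \<Longrightarrow> f (c *\<^sub>C x) = c * f x"
  by (simp add: cdual_def clinear_on_def)

lemma cdual_outside: "f \<in> cdual X N \<Longrightarrow> x \<notin> X \<Longrightarrow> f x = 0"
  by (simp add: cdual_def)

lemma cdual_zero: "f \<in> cdual X N \<Longrightarrow> x \<in> X \<Longrightarrow> f 0 = 0"
  using cdual_scale[of f X N x 0] by simp

lemma zero_ext_in_cdual:
  assumes X: "csubspace X" and "\<And>x y. x \<in> X \<Longrightarrow> y \<in> X \<Longrightarrow> f (x + y) = f x + f y"
    and "\<And>c x. x \<in> X \<Longrightarrow> f (c *\<^sub>C x) = c * f x"
    and "\<And>x. x \<in> X \<Longrightarrow> cmod (f x) \<le> K * N x"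
  shows "zero_ext X f \<in> cdual X N"
  using assms unfolding cdual_def clinear_on_def csubspace_def
  by (auto intro!: exI[of _ K])

lemma cdual_eqI:
  assumes "f \<in> cdual X N" "g \<in> cdual X N" "\<And>x. x \<in> X \<Longrightarrow> f x = g x"
  shows "f = g"
proof
  fix x
  show "f x = g x"
    using assms by (cases "x \<in> X") (auto simp: cdual_outside)
qed

lemma csubspace_cdual: "csubspace (cdual X N)"
  unfolding csubspace_def
proof (intro conjI ballI allI)
  show "0 \<in> cdual X N"
    by (auto simp: cdual_def clinear_on_def intro: exI[of _ 0])
next
  fix f g
  assume f: "f \<in> cdual X N" and g: "g \<in> cdual X N"
  obtain K where K: "\<And>x. x \<in> X \<Longrightarrow> cmod (f x) \<le> K * N x"
    using f by (auto simp: cdual_def)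
  obtain L where L: "\<And>x. x \<in> X \<Longrightarrow> cmod (g x) \<le> L * N x"
    using g by (auto simp: cdual_def)
  have "cmod (f x + g x) \<le> (K + L) * N x" if "x \<in> X" for x
    using norm_triangle_mono[OF K[OF that] L[OF that]] by (simp add: distrib_right)
  then have "\<exists>M. \<forall>x\<in>X. cmod (f x + g x) \<le> M * N x"
    by blast
  then show "f + g \<in> cdual X N"
    using f g unfolding cdual_def clinear_on_def by (auto simp: algebra_simps)
next
  fix f c
  assume f: "f \<in> cdual X N"
  obtain K where K: "\<And>x. x \<in> X \<Longrightarrow> cmod (f x) \<le> K * N x"
    using f by (auto simp: cdual_def)
  have "cmod (c * f x) \<le> (cmod c * K) * N x" if "x \<in> X" for x
    using mult_left_mono[OF K[OF that], of "cmod c"] by (simp add: norm_mult mult_ac)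
  then have "\<exists>M. \<forall>x\<in>X. cmod (c * f x) \<le> M * N x"
    by blast
  then show "c *\<^sub>C f \<in> cdual X N"
    using f unfolding cdual_def clinear_on_def by (auto simp: algebra_simps)
qed


section \<open>The Arens product\<close>

text \<open>This and \<open>left_act\<close> name the intermediate functionals
  \<open>\<phi> \<cdot> a\<close> and \<open>\<eta> \<cdot> \<phi>\<close> that are nested inside
  \<open>arens_mult\<close>, so that the two module actions on the dual can be studied
  separately.\<close>

definition right_act :: "'h::chilbert_space op set \<Rightarrow> 'h functional \<Rightarrow> 'h op \<Rightarrow> 'h functional"
  where "right_act T \<phi> a = zero_ext T (\<lambda>b. \<phi> (a o\<^sub>L b))"

definition left_act ::
    "'h::chilbert_space op set \<Rightarrow> 'h bifunctional \<Rightarrow> 'h functional \<Rightarrow> 'h functional"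
  where "left_act T \<eta> \<phi> = zero_ext T (\<lambda>a. \<eta> (right_act T \<phi> a))"

definition functional_adj :: "'h::chilbert_space op set \<Rightarrow> 'h functional \<Rightarrow> 'h functional"
  where "functional_adj T \<phi> = zero_ext T (\<lambda>a. cnj (\<phi> (adj a)))"

text \<open>This will turn out to be the weak-* continuous extension of \<psi>. Extension by zero
  outside the bidual matches the convention in \<open>normal_functionals\<close>, so equality of
  functions is meaningful.\<close>

definition evaluation ::
    "'h::chilbert_space op set \<Rightarrow> 'h functional \<Rightarrow> 'h bifunctional \<Rightarrow> complex"
  where "evaluation T \<psi> = zero_ext (bidual T) (\<lambda>\<xi>. \<xi> \<psi>)"

lemma arens_mult_apply: "\<phi> \<in> dual T \<Longrightarrow> arens_mult T \<xi> \<eta> \<phi> = \<xi> (left_act T \<eta> \<phi>)"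
  by (simp add: arens_mult_def left_act_def right_act_def)

lemma bidual_star_apply: "\<phi> \<in> dual T \<Longrightarrow> bidual_star T \<xi> \<phi> = cnj (\<xi> (functional_adj T \<phi>))"
  by (simp add: bidual_star_def functional_adj_def)

lemma embed_apply: "\<phi> \<in> dual T \<Longrightarrow> embed T t \<phi> = \<phi> t"
  by (simp add: embed_def)

lemma compose_add_left: "(a + b) o\<^sub>L c = (a o\<^sub>L c) + (b o\<^sub>L c)"
  by (rule blinfun_eqI) (simp add: blinfun.add_left)

lemma compose_scaleC_left: "(k *\<^sub>C a) o\<^sub>L c = k *\<^sub>C (a o\<^sub>L c)"
  by (rule blinfun_eqI) simp

lemma compose_add_right: "a o\<^sub>L (b + c) = (a o\<^sub>L b) + (a o\<^sub>L c)"
  by (rule blinfun_eqI) (simp add: blinfun.add_left blinfun.add_right)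

lemma compose_scaleC_right: "a \<in> BH \<Longrightarrow> a o\<^sub>L (k *\<^sub>C c) = k *\<^sub>C (a o\<^sub>L c)"
  by (rule blinfun_eqI) (simp add: BH_scaleC)

lemma compose_id [simp]: "id_blinfun o\<^sub>L a = a" "a o\<^sub>L id_blinfun = a"
  by (rule blinfun_eqI, simp)+

lemma compose_assoc: "(a o\<^sub>L b) o\<^sub>L c = a o\<^sub>L (b o\<^sub>L c)"
  by (rule blinfun_eqI) simp

locale operator_cstar_algebra =
  fixes T :: "'h::chilbert_space op set"
  assumes cstar: "unital_cstar_subalgebra T"
begin

lemma in_BH: "t \<in> T \<Longrightarrow> t \<in> BH"
  using cstar by (auto simp: unital_cstar_subalgebra_def unital_closed_subalgebra_def)

lemma csubspace_T: "csubspace T"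
  using cstar by (auto simp: unital_cstar_subalgebra_def unital_closed_subalgebra_def)

lemma zero_in [simp]: "0 \<in> T"
  and add_in [simp]: "s \<in> T \<Longrightarrow> t \<in> T \<Longrightarrow> s + t \<in> T"
  and scaleC_in [simp]: "t \<in> T \<Longrightarrow> c *\<^sub>C t \<in> T"
  using csubspace_T by (auto simp: csubspace_def)

lemma id_in [simp]: "id_blinfun \<in> T"
  and compose_in [simp]: "s \<in> T \<Longrightarrow> t \<in> T \<Longrightarrow> s o\<^sub>L t \<in> T"
  and adj_in [simp]: "t \<in> T \<Longrightarrow> adj t \<in> T"
  using cstar by (auto simp: unital_cstar_subalgebra_def unital_closed_subalgebra_def)

section \<open>Linear and norm structure of the dual and the bidual\<close>

lemma csubspace_dual: "csubspace (dual T)"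
  by (simp add: dual_def csubspace_cdual)

lemma csubspace_bidual: "csubspace (bidual T)"
  by (simp add: bidual_def csubspace_cdual)

lemma dual_closed [simp]:
  shows "0 \<in> dual T" and "\<phi> \<in> dual T \<Longrightarrow> \<psi> \<in> dual T \<Longrightarrow> \<phi> + \<psi> \<in> dual T"
    and "\<phi> \<in> dual T \<Longrightarrow> c *\<^sub>C \<phi> \<in> dual T"
    and "\<phi> \<in> dual T \<Longrightarrow> \<psi> \<in> dual T \<Longrightarrow> \<phi> - \<psi> \<in> dual T"
  using csubspace_dual by (auto simp: csubspace_def csubspace_diff)

lemma bidual_closed [simp]:
  shows "0 \<in> bidual T" and "\<xi> \<in> bidual T \<Longrightarrow> \<eta> \<in> bidual T \<Longrightarrow> \<xi> + \<eta> \<in> bidual T"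
    and "\<xi> \<in> bidual T \<Longrightarrow> c *\<^sub>C \<xi> \<in> bidual T"
    and "\<xi> \<in> bidual T \<Longrightarrow> \<eta> \<in> bidual T \<Longrightarrow> \<xi> - \<eta> \<in> bidual T"
  using csubspace_bidual by (auto simp: csubspace_def csubspace_diff)

lemma dual_add: "\<phi> \<in> dual T \<Longrightarrow> s \<in> T \<Longrightarrow> t \<in> T \<Longrightarrow> \<phi> (s + t) = \<phi> s + \<phi> t"
  unfolding dual_def by (rule cdual_add)

lemma dual_scale: "\<phi> \<in> dual T \<Longrightarrow> t \<in> T \<Longrightarrow> \<phi> (c *\<^sub>C t) = c * \<phi> t"
  unfolding dual_def by (rule cdual_scale)

lemma zero_ext_dual [simp]: "\<phi> \<in> dual T \<Longrightarrow> zero_ext T \<phi> = \<phi>"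
  by (auto simp: zero_ext_def dual_def cdual_outside)

lemma dual_eqI:
  "\<phi> \<in> dual T \<Longrightarrow> \<psi> \<in> dual T \<Longrightarrow> (\<And>t. t \<in> T \<Longrightarrow> \<phi> t = \<psi> t) \<Longrightarrow> \<phi> = \<psi>"
  unfolding dual_def by (rule cdual_eqI)

lemma bidual_add:
  "\<xi> \<in> bidual T \<Longrightarrow> \<phi> \<in> dual T \<Longrightarrow> \<psi> \<in> dual T \<Longrightarrow> \<xi> (\<phi> + \<psi>) = \<xi> \<phi> + \<xi> \<psi>"
  using cdual_add[of \<xi> "dual T" "dual_norm T" \<phi> \<psi>] by (simp add: bidual_def)

lemma bidual_scale: "\<xi> \<in> bidual T \<Longrightarrow> \<phi> \<in> dual T \<Longrightarrow> \<xi> (c *\<^sub>C \<phi>) = c * \<xi> \<phi>"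
  using cdual_scale[of \<xi> "dual T" "dual_norm T" \<phi> c] by (simp add: bidual_def)

lemma bidual_eqI:
  "\<xi> \<in> bidual T \<Longrightarrow> \<eta> \<in> bidual T \<Longrightarrow> (\<And>\<phi>. \<phi> \<in> dual T \<Longrightarrow> \<xi> \<phi> = \<eta> \<phi>) \<Longrightarrow> \<xi> = \<eta>"
  using cdual_eqI[of \<xi> "dual T" "dual_norm T" \<eta>] by (simp add: bidual_def)

lemma bidual_zero: "\<xi> \<in> bidual T \<Longrightarrow> \<xi> 0 = 0"
  using cdual_zero[of \<xi> "dual T" "dual_norm T" 0] by (simp add: bidual_def)

lemma bidual_diff:
  assumes "\<xi> \<in> bidual T" "\<phi> \<in> dual T" "\<psi> \<in> dual T"
  shows "\<xi> (\<phi> - \<psi>) = \<xi> \<phi> - \<xi> \<psi>"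
  using bidual_add[OF assms(1), of "\<phi> - \<psi>" \<psi>] assms by simp

lemma dual_norm_upper:
  assumes "\<phi> \<in> dual T" "t \<in> T" "norm t \<le> 1"
  shows "cmod (\<phi> t) \<le> dual_norm T \<phi>"
  unfolding dual_norm_def
proof (rule cSup_upper)
  obtain K where K: "\<And>t. t \<in> T \<Longrightarrow> cmod (\<phi> t) \<le> K * norm t"
    using assms(1) by (auto simp: dual_def cdual_def)
  \<comment> \<open>The absolute value appears because membership in the dual does not fix the sign
    of the constant \<open>K\<close>.\<close>
  have "cmod (\<phi> s) \<le> \<bar>K\<bar>" if "s \<in> T" "norm s \<le> 1" for s
    using K[OF that(1)] mult_mono[OF abs_ge_self[of K] that(2)] by (simp add: abs_mult)
  then show "bdd_above {cmod (\<phi> t) |t. t \<in> T \<and> norm t \<le> 1}"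
    by (auto simp: bdd_above_def)
qed (use assms in auto)

lemma dual_norm_nonneg: "\<phi> \<in> dual T \<Longrightarrow> 0 \<le> dual_norm T \<phi>"
  using dual_norm_upper[of \<phi> 0] by (metis norm_ge_zero norm_zero order_trans zero_in zero_le_one)

lemma dual_bound:
  assumes \<phi>: "\<phi> \<in> dual T" and t: "t \<in> T"
  shows "cmod (\<phi> t) \<le> dual_norm T \<phi> * norm t"
proof (cases "t = 0")
  case True
  then show ?thesis
    using dual_scale[OF \<phi> t, of 0] by simp
next
  case False
  define s where "s = complex_of_real (1 / norm t) *\<^sub>C t"
  have "norm s \<le> 1"
    unfolding s_def scaleR_scaleC[symmetric] using False by simp
  then have "cmod (\<phi> s) \<le> dual_norm T \<phi>"
    using t by (intro dual_norm_upper \<phi>) (simp_all add: s_def)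
  moreover have "cmod (\<phi> s) = cmod (\<phi> t) / norm t"
    unfolding s_def dual_scale[OF \<phi> t] by (simp add: norm_divide)
  ultimately show ?thesis
    using False by (simp add: field_simps)
qed

lemma dual_norm_le:
  assumes "\<And>t. t \<in> T \<Longrightarrow> cmod (\<phi> t) \<le> K * norm t" "0 \<le> K"
  shows "dual_norm T \<phi> \<le> K"
  unfolding dual_norm_def
proof (rule cSup_least)
  show "{cmod (\<phi> t) |t. t \<in> T \<and> norm t \<le> 1} \<noteq> {}"
    using zero_in by (metis (mono_tags, lifting) empty_Collect_eq norm_zero zero_le_one)
  fix r
  assume "r \<in> {cmod (\<phi> t) |t. t \<in> T \<and> norm t \<le> 1}"
  then obtain t where t: "t \<in> T" "norm t \<le> 1" "r = cmod (\<phi> t)"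
    by blast
  then show "r \<le> K"
    using assms(1)[OF t(1)] mult_left_mono[OF t(2) assms(2)] by simp
qed

lemma zero_ext_in_dual:
  assumes "\<And>s t. s \<in> T \<Longrightarrow> t \<in> T \<Longrightarrow> f (s + t) = f s + f t"
    and "\<And>c t. t \<in> T \<Longrightarrow> f (c *\<^sub>C t) = c * f t"
    and "\<And>t. t \<in> T \<Longrightarrow> cmod (f t) \<le> K * norm t"
  shows "zero_ext T f \<in> dual T"
  unfolding dual_def by (rule zero_ext_in_cdual[OF csubspace_T]) (use assms in auto)

lemma zero_ext_in_bidual:
  assumes "\<And>\<phi> \<psi>. \<phi> \<in> dual T \<Longrightarrow> \<psi> \<in> dual T \<Longrightarrow> f (\<phi> + \<psi>) = f \<phi> + f \<psi>"
    and "\<And>c \<phi>. \<phi> \<in> dual T \<Longrightarrow> f (c *\<^sub>C \<phi>) = c * f \<phi>"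
    and "\<And>\<phi>. \<phi> \<in> dual T \<Longrightarrow> cmod (f \<phi>) \<le> K * dual_norm T \<phi>"
  shows "zero_ext (dual T) f \<in> bidual T"
  unfolding bidual_def by (rule zero_ext_in_cdual[OF csubspace_dual]) (use assms in auto)

lemma bidual_bound:
  assumes "\<xi> \<in> bidual T"
  obtains K where "0 \<le> K" "\<And>\<phi>. \<phi> \<in> dual T \<Longrightarrow> cmod (\<xi> \<phi>) \<le> K * dual_norm T \<phi>"
proof -
  obtain K where K: "\<And>\<phi>. \<phi> \<in> dual T \<Longrightarrow> cmod (\<xi> \<phi>) \<le> K * dual_norm T \<phi>"
    using assms by (auto simp: bidual_def cdual_def)
  have "cmod (\<xi> \<phi>) \<le> \<bar>K\<bar> * dual_norm T \<phi>" if "\<phi> \<in> dual T" for \<phi>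
    using K[OF that] mult_right_mono[OF abs_ge_self[of K] dual_norm_nonneg[OF that]] by linarith
  then show ?thesis
    using that[of "\<bar>K\<bar>"] by simp
qed

section \<open>Module actions on the dual and boundedness of the Arens product\<close>

lemma right_act_bound:
  assumes "\<phi> \<in> dual T" "a \<in> T" "b \<in> T"
  shows "cmod (\<phi> (a o\<^sub>L b)) \<le> (dual_norm T \<phi> * norm a) * norm b"
proof -
  have "cmod (\<phi> (a o\<^sub>L b)) \<le> dual_norm T \<phi> * norm (a o\<^sub>L b)"
    using assms by (intro dual_bound) auto
  also have "\<dots> \<le> dual_norm T \<phi> * (norm a * norm b)"
    using assms by (intro mult_left_mono norm_blinfun_compose dual_norm_nonneg)
  finally show ?thesis
    by (simp add: mult.assoc)
qed

lemma right_act_in_dual [simp]: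
  assumes "\<phi> \<in> dual T" "a \<in> T"
  shows "right_act T \<phi> a \<in> dual T"
  unfolding right_act_def
  by (rule zero_ext_in_dual[where K = "dual_norm T \<phi> * norm a"])
    (use assms in \<open>simp_all add: compose_add_right compose_scaleC_right in_BH dual_add dual_scale
      right_act_bound\<close>)

lemma dual_norm_right_act_le:
  assumes "\<phi> \<in> dual T" "a \<in> T"
  shows "dual_norm T (right_act T \<phi> a) \<le> dual_norm T \<phi> * norm a"
  by (rule dual_norm_le)
    (use assms in \<open>simp_all add: right_act_def right_act_bound dual_norm_nonneg\<close>)

lemma right_act_add_op:
  "\<phi> \<in> dual T \<Longrightarrow> a \<in> T \<Longrightarrow> b \<in> T \<Longrightarrow> right_act T \<phi> (a + b) = right_act T \<phi> a + right_act T \<phi> b"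
  unfolding right_act_def zero_ext_add[symmetric]
  by (rule zero_ext_eqI) (simp add: compose_add_left dual_add)

lemma right_act_scaleC_op:
  "\<phi> \<in> dual T \<Longrightarrow> a \<in> T \<Longrightarrow> right_act T \<phi> (c *\<^sub>C a) = c *\<^sub>C right_act T \<phi> a"
  unfolding right_act_def zero_ext_scaleC[symmetric]
  by (rule zero_ext_eqI) (simp add: compose_scaleC_left dual_scale)

lemma right_act_add: "right_act T (\<phi> + \<psi>) a = right_act T \<phi> a + right_act T \<psi> a"
  by (simp add: right_act_def flip: zero_ext_add)

lemma right_act_scaleC: "right_act T (c *\<^sub>C \<phi>) a = c *\<^sub>C right_act T \<phi> a"
  by (simp add: right_act_def flip: zero_ext_scaleC)

lemma left_act_bound:
  assumes K: "0 \<le> K" "\<And>\<phi>. \<phi> \<in> dual T \<Longrightarrow> cmod (\<eta> \<phi>) \<le> K * dual_norm T \<phi>"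
    and \<phi>: "\<phi> \<in> dual T" and a: "a \<in> T"
  shows "cmod (\<eta> (right_act T \<phi> a)) \<le> (K * dual_norm T \<phi>) * norm a"
proof -
  have "cmod (\<eta> (right_act T \<phi> a)) \<le> K * dual_norm T (right_act T \<phi> a)"
    using \<phi> a by (intro K) simp
  also have "\<dots> \<le> K * (dual_norm T \<phi> * norm a)"
    using \<phi> a by (intro mult_left_mono dual_norm_right_act_le K)
  finally show ?thesis
    by (simp add: mult.assoc)
qed

lemma left_act_in_dual [simp]:
  assumes \<eta>: "\<eta> \<in> bidual T" and \<phi>: "\<phi> \<in> dual T"
  shows "left_act T \<eta> \<phi> \<in> dual T"
proof -
  obtain K where K: "0 \<le> K" "\<And>\<phi>. \<phi> \<in> dual T \<Longrightarrow> cmod (\<eta> \<phi>) \<le> K * dual_norm T \<phi>"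
    using bidual_bound[OF \<eta>] by blast
  show ?thesis
    unfolding left_act_def
    by (rule zero_ext_in_dual[where K = "K * dual_norm T \<phi>"])
      (use assms in \<open>simp_all add: right_act_add_op right_act_scaleC_op bidual_add bidual_scale
        left_act_bound[OF K]\<close>)
qed

lemma left_act_add:
  "\<eta> \<in> bidual T \<Longrightarrow> \<phi> \<in> dual T \<Longrightarrow> \<psi> \<in> dual T \<Longrightarrow>
    left_act T \<eta> (\<phi> + \<psi>) = left_act T \<eta> \<phi> + left_act T \<eta> \<psi>"
  unfolding left_act_def zero_ext_add[symmetric]
  by (rule zero_ext_eqI) (simp add: right_act_add bidual_add)

lemma left_act_scaleC:
  "\<eta> \<in> bidual T \<Longrightarrow> \<phi> \<in> dual T \<Longrightarrow> left_act T \<eta> (c *\<^sub>C \<phi>) = c *\<^sub>C left_act T \<eta> \<phi>"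
  unfolding left_act_def zero_ext_scaleC[symmetric]
  by (rule zero_ext_eqI) (simp add: right_act_scaleC bidual_scale)

lemma left_act_add_bidual: "left_act T (\<eta> + \<zeta>) \<phi> = left_act T \<eta> \<phi> + left_act T \<zeta> \<phi>"
  by (simp add: left_act_def flip: zero_ext_add)

lemma left_act_scaleC_bidual: "left_act T (c *\<^sub>C \<eta>) \<phi> = c *\<^sub>C left_act T \<eta> \<phi>"
  by (simp add: left_act_def flip: zero_ext_scaleC)

lemma left_act_diff_bidual: "left_act T (\<eta> - \<zeta>) \<phi> = left_act T \<eta> \<phi> - left_act T \<zeta> \<phi>"
  using left_act_add_bidual[of "\<eta> - \<zeta>" \<zeta> \<phi>] by (simp add: eq_diff_eq)

lemma arens_in_bidual [simp]:
  assumes \<xi>: "\<xi> \<in> bidual T" and \<eta>: "\<eta> \<in> bidual T"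
  shows "arens_mult T \<xi> \<eta> \<in> bidual T"
proof -
  obtain K where K: "0 \<le> K" "\<And>\<phi>. \<phi> \<in> dual T \<Longrightarrow> cmod (\<xi> \<phi>) \<le> K * dual_norm T \<phi>"
    using bidual_bound[OF \<xi>] by blast
  obtain L where L: "0 \<le> L" "\<And>\<phi>. \<phi> \<in> dual T \<Longrightarrow> cmod (\<eta> \<phi>) \<le> L * dual_norm T \<phi>"
    using bidual_bound[OF \<eta>] by blast
  have "cmod (\<xi> (left_act T \<eta> \<phi>)) \<le> (K * L) * dual_norm T \<phi>" if \<phi>: "\<phi> \<in> dual T" for \<phi>
  proof -
    have "dual_norm T (left_act T \<eta> \<phi>) \<le> L * dual_norm T \<phi>"
      by (rule dual_norm_le)
        (use L \<phi> in \<open>simp_all add: left_act_def left_act_bound[OF L] dual_norm_nonneg\<close>)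
    then show ?thesis
      using K(2)[of "left_act T \<eta> \<phi>"] mult_left_mono[of _ _ K] K(1) \<eta> \<phi>
      by (fastforce simp: mult.assoc)
  qed
  then have "zero_ext (dual T) (\<lambda>\<phi>. \<xi> (left_act T \<eta> \<phi>)) \<in> bidual T"
    by (intro zero_ext_in_bidual[where K = "K * L"])
      (use assms in \<open>simp_all add: left_act_add left_act_scaleC bidual_add bidual_scale\<close>)
  then show ?thesis
    by (simp add: arens_mult_def left_act_def right_act_def)
qed

section \<open>Involution, embedding of the algebra, unit and associativity\<close>

lemma functional_adj_bound:
  assumes "\<phi> \<in> dual T" "a \<in> T"
  shows "cmod (cnj (\<phi> (adj a))) \<le> dual_norm T \<phi> * norm a"
proof -
  have "cmod (\<phi> (adj a)) \<le> dual_norm T \<phi> * norm (adj a)"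
    using assms by (intro dual_bound) auto
  also have "\<dots> \<le> dual_norm T \<phi> * norm a"
    using assms by (intro mult_left_mono norm_adj_le dual_norm_nonneg in_BH)
  finally show ?thesis
    by simp
qed

lemma functional_adj_in_dual [simp]:
  assumes "\<phi> \<in> dual T"
  shows "functional_adj T \<phi> \<in> dual T"
  unfolding functional_adj_def
  by (rule zero_ext_in_dual[where K = "dual_norm T \<phi>"])
    (use assms functional_adj_bound in \<open>simp_all add: adj_add adj_scaleC in_BH dual_add dual_scale\<close>)

lemma functional_adj_add: "functional_adj T (\<phi> + \<psi>) = functional_adj T \<phi> + functional_adj T \<psi>"
  by (simp add: functional_adj_def flip: zero_ext_add)

lemma functional_adj_scaleC: "functional_adj T (c *\<^sub>C \<phi>) = cnj c *\<^sub>C functional_adj T \<phi>"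
  by (simp add: functional_adj_def flip: zero_ext_scaleC)

lemma bidual_star_in_bidual [simp]:
  assumes \<xi>: "\<xi> \<in> bidual T"
  shows "bidual_star T \<xi> \<in> bidual T"
proof -
  obtain K where K: "0 \<le> K" "\<And>\<phi>. \<phi> \<in> dual T \<Longrightarrow> cmod (\<xi> \<phi>) \<le> K * dual_norm T \<phi>"
    using bidual_bound[OF \<xi>] by blast
  have "cmod (cnj (\<xi> (functional_adj T \<phi>))) \<le> K * dual_norm T \<phi>" if \<phi>: "\<phi> \<in> dual T" for \<phi>
  proof -
    have "dual_norm T (functional_adj T \<phi>) \<le> dual_norm T \<phi>"
      by (rule dual_norm_le)
        (use \<phi> functional_adj_bound in \<open>simp_all add: functional_adj_def dual_norm_nonneg\<close>)
    then show ?thesis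
      using K(2)[of "functional_adj T \<phi>"] mult_left_mono[of _ _ K] K(1) \<phi> by fastforce
  qed
  then have "zero_ext (dual T) (\<lambda>\<phi>. cnj (\<xi> (functional_adj T \<phi>))) \<in> bidual T"
    by (intro zero_ext_in_bidual[where K = K])
      (use assms in \<open>simp_all add: functional_adj_add functional_adj_scaleC bidual_add bidual_scale\<close>)
  then show ?thesis
    by (simp add: bidual_star_def functional_adj_def)
qed

lemma embed_in_bidual [simp]: "t \<in> T \<Longrightarrow> embed T t \<in> bidual T"
  unfolding embed_def
  by (rule zero_ext_in_bidual[where K = "norm t"]) (use dual_bound in \<open>simp_all add: mult.commute\<close>)

lemma one_in_bidual [simp]: "bidual_one T \<in> bidual T"
  by (simp add: bidual_one_def)

lemma right_act_id: "\<phi> \<in> dual T \<Longrightarrow> right_act T \<phi> id_blinfun = \<phi>"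
  by (rule dual_eqI) (simp_all add: right_act_def)

lemma left_act_embed:
  "t \<in> T \<Longrightarrow> \<phi> \<in> dual T \<Longrightarrow> left_act T (embed T t) \<phi> = zero_ext T (\<lambda>a. \<phi> (a o\<^sub>L t))"
  unfolding left_act_def
  by (rule zero_ext_eqI) (simp add: embed_apply, simp add: right_act_def)

lemma left_act_one: "\<phi> \<in> dual T \<Longrightarrow> left_act T (bidual_one T) \<phi> = \<phi>"
  by (rule dual_eqI) (simp_all add: bidual_one_def left_act_embed)

lemma arens_one_right: "\<xi> \<in> bidual T \<Longrightarrow> arens_mult T \<xi> (bidual_one T) = \<xi>"
  by (rule bidual_eqI) (simp_all add: arens_mult_apply left_act_one)

lemma arens_one_left: "\<xi> \<in> bidual T \<Longrightarrow> arens_mult T (bidual_one T) \<xi> = \<xi>"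
proof (rule bidual_eqI)
  fix \<phi>
  assume "\<xi> \<in> bidual T" "\<phi> \<in> dual T"
  then show "arens_mult T (bidual_one T) \<xi> \<phi> = \<xi> \<phi>"
    by (simp add: arens_mult_apply bidual_one_def embed_apply) (simp add: left_act_def right_act_id)
qed simp_all

lemma arens_diff_right:
  "\<xi> \<in> bidual T \<Longrightarrow> \<eta> \<in> bidual T \<Longrightarrow> \<zeta> \<in> bidual T \<Longrightarrow>
    arens_mult T \<xi> (\<eta> - \<zeta>) = arens_mult T \<xi> \<eta> - arens_mult T \<xi> \<zeta>"
  by (rule bidual_eqI) (simp_all add: arens_mult_apply left_act_diff_bidual bidual_diff)

lemma right_act_right_act:
  "a \<in> T \<Longrightarrow> b \<in> T \<Longrightarrow> right_act T (right_act T \<phi> a) b = right_act T \<phi> (a o\<^sub>L b)"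
  unfolding right_act_def by (rule zero_ext_eqI) (simp add: compose_assoc)

lemma right_act_left_act:
  "a \<in> T \<Longrightarrow> right_act T (left_act T \<eta> \<phi>) a = left_act T \<eta> (right_act T \<phi> a)"
  unfolding right_act_def[of _ "left_act T \<eta> \<phi>"] unfolding left_act_def
  by (rule zero_ext_eqI) (simp add: right_act_right_act)

text \<open>The dual is a left module over the bidual, because \<open>left_act\<close> commutes with
  \<open>right_act\<close>. Associativity of the Arens product is this module law paired with a
  third element.\<close>

lemma left_act_arens:
  assumes "\<eta> \<in> bidual T" "\<zeta> \<in> bidual T" "\<phi> \<in> dual T"
  shows "left_act T (arens_mult T \<eta> \<zeta>) \<phi> = left_act T \<eta> (left_act T \<zeta> \<phi>)"
  unfolding left_act_def[of _ "arens_mult T \<eta> \<zeta>"] left_act_def[of _ \<eta>]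
  by (rule zero_ext_eqI) (use assms in \<open>simp add: arens_mult_apply right_act_left_act\<close>)

lemma arens_assoc:
  "\<xi> \<in> bidual T \<Longrightarrow> \<eta> \<in> bidual T \<Longrightarrow> \<zeta> \<in> bidual T \<Longrightarrow>
    arens_mult T (arens_mult T \<xi> \<eta>) \<zeta> = arens_mult T \<xi> (arens_mult T \<eta> \<zeta>)"
  by (rule bidual_eqI) (simp_all add: arens_mult_apply left_act_arens)

lemma arens_embed:
  assumes "s \<in> T" "t \<in> T"
  shows "arens_mult T (embed T s) (embed T t) = embed T (s o\<^sub>L t)"
  by (rule bidual_eqI) (use assms in \<open>simp_all add: arens_mult_apply embed_apply\<close>,
      simp add: left_act_embed)

lemma star_embed: "t \<in> T \<Longrightarrow> bidual_star T (embed T t) = embed T (adj t)"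
  by (rule bidual_eqI) (simp_all add: bidual_star_apply embed_apply, simp add: functional_adj_def)


section \<open>Weak-* continuous functionals on the bidual\<close>

lemma evaluation_apply [simp]: "\<xi> \<in> bidual T \<Longrightarrow> evaluation T \<psi> \<xi> = \<xi> \<psi>"
  by (simp add: evaluation_def)

lemma topspace_weak_star_bidual: "topspace (weak_star_bidual T) = bidual T"
  unfolding weak_star_bidual_def by (rule topspace_weak_topology) (use dual_closed(1) in blast)

lemma evaluation_normal:
  assumes "\<psi> \<in> dual T"
  shows "evaluation T \<psi> \<in> normal_functionals T"
proof -
  have mem: "(\<lambda>\<xi>. \<xi> \<psi>) \<in> {\<lambda>\<xi>. \<xi> \<phi> |\<phi>. \<phi> \<in> dual T}"
    unfolding mem_Collect_eq by (rule exI[of _ \<psi>]) (use assms in simp)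
  have "openin (weak_star_bidual T) {\<xi> \<in> bidual T. \<xi> \<psi> \<in> U}" if "open U" for U
    unfolding weak_star_bidual_def weak_topology_def
  proof (rule topology_generated_by_Basis, unfold mem_Collect_eq)
    show "\<exists>f V. {\<xi> \<in> bidual T. \<xi> \<psi> \<in> U} = {\<xi> \<in> bidual T. f \<xi> \<in> V} \<and>
        (\<exists>\<phi>. f = (\<lambda>\<xi>. \<xi> \<phi>) \<and> \<phi> \<in> dual T) \<and> open V"
      by (rule exI[of _ "\<lambda>\<xi>. \<xi> \<psi>"], rule exI[of _ U]) (use mem that in simp)
  qed
  then have "continuous_map (weak_star_bidual T) euclidean (\<lambda>\<xi>. \<xi> \<psi>)"
    by (simp add: continuous_map_def topspace_weak_star_bidual)
  then have "continuous_map (weak_star_bidual T) euclidean (evaluation T \<psi>)"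
    by (rule continuous_map_eq) (simp add: topspace_weak_star_bidual)
  then show ?thesis
    by (simp add: normal_functionals_def clinear_on_def evaluation_def)
qed

lemma bidual_sum:
  assumes "finite S" "S \<subseteq> dual T" "\<xi> \<in> bidual T"
  shows "(\<Sum>\<phi>\<in>S. c \<phi> *\<^sub>C \<phi>) \<in> dual T \<and> \<xi> (\<Sum>\<phi>\<in>S. c \<phi> *\<^sub>C \<phi>) = (\<Sum>\<phi>\<in>S. c \<phi> * \<xi> \<phi>)"
  using assms
  by (induction S rule: finite_induct) (simp_all add: bidual_zero bidual_add bidual_scale)

text \<open>The preimage of the unit disc contains a basic neighbourhood of 0, which restrains only
  finitely many evaluations. Hence \<open>f\<close> vanishes where these vanish and is a linear
  combination of them, that is, evaluation at a single element of the dual.\<close>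

lemma normal_functional_is_evaluation:
  assumes f: "f \<in> normal_functionals T"
  shows "\<exists>\<psi>\<in>dual T. f = evaluation T \<psi>"
proof -
  have lin: "clinear_on (bidual T) f" and cont: "continuous_map (weak_star_bidual T) euclidean f"
    and outside: "\<And>\<xi>. \<xi> \<notin> bidual T \<Longrightarrow> f \<xi> = 0"
    using f by (auto simp: normal_functionals_def)
  have scale: "f (c *\<^sub>C \<xi>) = c * f \<xi>" if "\<xi> \<in> bidual T" for c \<xi>
    using lin that by (simp add: clinear_on_def)
  have f0: "f 0 = 0"
    using scale[of 0 0] by simp
  define V where "V = {\<xi> \<in> bidual T. f \<xi> \<in> ball 0 1}"
  have "openin (weak_topology (bidual T) {\<lambda>\<xi>. \<xi> \<phi> |\<phi>. \<phi> \<in> dual T}) V"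
    using openin_continuous_map_preimage[OF cont, of "ball 0 1"]
    by (simp add: V_def topspace_weak_star_bidual flip: weak_star_bidual_def)
  moreover have "0 \<in> V"
    by (simp add: V_def f0)
  ultimately obtain S' e where S': "finite S'" "S' \<subseteq> {\<lambda>\<xi>. \<xi> \<phi> |\<phi>. \<phi> \<in> dual T}" "e > 0"
    "\<forall>\<xi>\<in>bidual T. (\<forall>g\<in>S'. cmod (g \<xi> - g 0) < e) \<longrightarrow> \<xi> \<in> V"
    by (rule exE[OF weak_topology_basic_neighbourhood]) (elim exE conjE, rule that; assumption)
  have "S' \<subseteq> (\<lambda>\<phi> \<xi>. \<xi> \<phi>) ` dual T"
    using S'(2) by auto
  then obtain S where S: "finite S" "S \<subseteq> dual T" "S' = (\<lambda>\<phi> \<xi>. \<xi> \<phi>) ` S"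
    using finite_subset_image[OF S'(1)] by metis
  have "\<exists>c. \<forall>\<xi>\<in>bidual T. f \<xi> = (\<Sum>\<phi>\<in>S. c \<phi> * \<xi> \<phi>)"
  proof (rule clinear_on_sum_of_common_kernel[OF S(1) csubspace_bidual lin])
    show "clinear_on (bidual T) (\<lambda>\<xi>. \<xi> \<phi>)" for \<phi>
      by (simp add: clinear_on_def)
    fix \<xi>
    assume \<xi>: "\<xi> \<in> bidual T" and zero: "\<And>\<phi>. \<phi> \<in> S \<Longrightarrow> \<xi> \<phi> = 0"
    \<comment> \<open>The rescaled element still lies in the common kernel, hence in
      \<open>V\<close>. If \<open>f \<xi>\<close> were nonzero, \<open>f\<close> would take the
      value 1 there, outside the open unit disc; if \<open>f \<xi> = 0\<close>, the scalar is 0 by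
      convention.\<close>
    have "\<forall>g\<in>S'. cmod (g ((1 / f \<xi>) *\<^sub>C \<xi>) - g 0) < e"
      unfolding S(3) using zero S'(3) by simp
    then have "(1 / f \<xi>) *\<^sub>C \<xi> \<in> V"
      using S'(4) bidual_closed(3)[OF \<xi>] by blast
    then show "f \<xi> = 0"
      using scale[OF \<xi>, of "1 / f \<xi>"] by (auto simp: V_def split: if_splits)
  qed
  then obtain c where c: "\<And>\<xi>. \<xi> \<in> bidual T \<Longrightarrow> f \<xi> = (\<Sum>\<phi>\<in>S. c \<phi> * \<xi> \<phi>)"
    by blast
  define \<psi> where "\<psi> = (\<Sum>\<phi>\<in>S. c \<phi> *\<^sub>C \<phi>)"
  have "f \<xi> = evaluation T \<psi> \<xi>" for \<xi>
    using c[of \<xi>] bidual_sum[OF S(1,2), of \<xi> c] outside[of \<xi>]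
    by (cases "\<xi> \<in> bidual T") (simp_all add: \<psi>_def evaluation_def)
  moreover have "\<psi> \<in> dual T"
    using bidual_sum[OF S(1,2), of 0 c] by (simp add: \<psi>_def)
  ultimately show ?thesis
    by blast
qed

text \<open>Any competing extension is evaluation at some \<psi>, and its values on the embedded
  algebra are the values of \<psi>, which gives uniqueness.\<close>

lemma normal_ext_eq_evaluation:
  assumes \<phi>: "\<phi> \<in> dual T"
  shows "normal_ext T \<phi> = evaluation T \<phi>"
  unfolding normal_ext_def
proof (rule the_equality)
  show "evaluation T \<phi> \<in> normal_functionals T \<and> (\<forall>t\<in>T. evaluation T \<phi> (embed T t) = \<phi> t)"
    using \<phi> by (simp add: evaluation_normal embed_apply)
  fix f
  assume f: "f \<in> normal_functionals T \<and> (\<forall>t\<in>T. f (embed T t) = \<phi> t)"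
  then obtain \<psi> where \<psi>: "\<psi> \<in> dual T" "f = evaluation T \<psi>"
    using normal_functional_is_evaluation by blast
  have "\<psi> = \<phi>"
    by (rule dual_eqI) (use f \<psi> \<phi> in \<open>auto simp: embed_apply\<close>)
  then show "f = evaluation T \<phi>"
    by (simp add: \<psi>)
qed

end


section \<open>Vector functionals\<close>

definition vector_functional ::
    "'h::chilbert_space op set \<Rightarrow> 'h \<Rightarrow> 'h \<Rightarrow> 'h functional"
  where "vector_functional T h k = zero_ext T (\<lambda>t. cinner (blinfun_apply t h) k)"

text \<open>This is the extension to the bidual of the representation of the algebra on the Hilbert
  space, prescribed through its matrix coefficients. For \<open>\<xi>\<close> in the bidual the
  chosen vector exists by the Riesz theorem.\<close>

definition bidual_act :: "'h::chilbert_space op set \<Rightarrow> 'h bifunctional \<Rightarrow> 'h \<Rightarrow> 'h"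
  where "bidual_act T \<xi> h = (SOME z. \<forall>k. \<xi> (vector_functional T h k) = cinner z k)"

lemma vector_functional_add_right:
  "vector_functional T h (k + k') = vector_functional T h k + vector_functional T h k'"
  by (simp add: vector_functional_def cinner_add_right flip: zero_ext_add)

lemma vector_functional_scaleC_right:
  "vector_functional T h (c *\<^sub>C k) = cnj c *\<^sub>C vector_functional T h k"
  by (simp add: vector_functional_def cinner_scaleC_right flip: zero_ext_scaleC)

lemma vector_functional_zero [simp]:
  "vector_functional T 0 k = 0" "vector_functional T h 0 = 0"
  by (auto simp: vector_functional_def zero_ext_def)

context operator_cstar_algebra
begin

abbreviation "vf \<equiv> vector_functional T"
abbreviation "act \<equiv> bidual_act T"
abbreviation mult (infixl "\<star>" 70) where "mult \<equiv> arens_mult T"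

lemma vector_functional_apply: "t \<in> T \<Longrightarrow> vf h k t = cinner (blinfun_apply t h) k"
  by (simp add: vector_functional_def)

lemma vector_functional_scaleC_left: "vf (c *\<^sub>C h) k = c *\<^sub>C vf h k"
  unfolding vector_functional_def zero_ext_scaleC[symmetric]
  by (rule zero_ext_eqI) (simp add: BH_scaleC in_BH cinner_scaleC_left)

lemma vector_functional_bound:
  fixes t :: "'h op"
  shows "cmod (cinner (blinfun_apply t h) k) \<le> (norm h * norm k) * norm t"
proof -
  have "cmod (cinner (blinfun_apply t h) k) \<le> norm (blinfun_apply t h) * norm k"
    by (rule Cauchy_Schwarz_cinner)
  also have "\<dots> \<le> (norm t * norm h) * norm k"
    by (intro mult_right_mono norm_blinfun) simp
  finally show ?thesis
    by (simp add: mult_ac)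
qed

lemma vector_functional_in_dual [simp]: "vf h k \<in> dual T"
  unfolding vector_functional_def
  by (rule zero_ext_in_dual[where K = "norm h * norm k"])
    (simp_all add: blinfun.add_left cinner_add_left cinner_scaleC_left vector_functional_bound)

lemma dual_norm_vector_functional_le: "dual_norm T (vf h k) \<le> norm h * norm k"
  by (rule dual_norm_le) (simp_all add: vector_functional_apply vector_functional_bound)

lemma bidual_act:
  assumes \<xi>: "\<xi> \<in> bidual T"
  shows "\<xi> (vf h k) = cinner (act \<xi> h) k"
proof -
  obtain K where K: "0 \<le> K" "\<And>\<phi>. \<phi> \<in> dual T \<Longrightarrow> cmod (\<xi> \<phi>) \<le> K * dual_norm T \<phi>"
    using bidual_bound[OF \<xi>] by blast
  \<comment> \<open>The map \<open>k \<mapsto> \<xi> (vf h k)\<close> is conjugate-linear, so its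
    conjugate is the functional to represent.\<close>
  have "\<exists>z. \<forall>k. cnj (\<xi> (vf h k)) = cinner k z"
  proof (rule Riesz_representation[where K = "K * norm h"])
    show "cmod (cnj (\<xi> (vf h k))) \<le> K * norm h * norm k" for k
    proof -
      have "cmod (\<xi> (vf h k)) \<le> K * dual_norm T (vf h k)"
        by (simp add: K)
      also have "\<dots> \<le> K * (norm h * norm k)"
        by (intro mult_left_mono dual_norm_vector_functional_le K)
      finally show ?thesis
        by (simp add: mult.assoc)
    qed
  qed (simp_all add: vector_functional_add_right vector_functional_scaleC_right
      bidual_add[OF \<xi>] bidual_scale[OF \<xi>])
  then obtain z where z: "\<And>k. cnj (\<xi> (vf h k)) = cinner k z"
    by blast
  have "\<forall>k. \<xi> (vf h k) = cinner z k"
    unfolding cinner_commute[of z] z[symmetric] by simp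
  then have "\<forall>k. \<xi> (vf h k) = cinner (act \<xi> h) k"
    unfolding bidual_act_def by (rule someI)
  then show ?thesis
    by (rule spec)
qed

lemma bidual_act_eq_zero_iff:
  assumes "\<xi> \<in> bidual T"
  shows "act \<xi> h = 0 \<longleftrightarrow> (\<forall>k. \<xi> (vf h k) = 0)"
proof
  assume "\<forall>k. \<xi> (vf h k) = 0"
  then have "cinner (act \<xi> h) (act \<xi> h) = 0"
    by (simp add: bidual_act[OF assms])
  then show "act \<xi> h = 0"
    by simp
qed (simp add: bidual_act[OF assms])

text \<open>It rests on \<open>\<phi> \<cdot> a\<close> being the functional of \<open>h\<close> and
  \<open>adj a\<close> applied to \<open>k\<close> when \<phi> is that of \<open>h\<close> and
  \<open>k\<close>. Thus on vector functionals the Arens product becomes composition of the actions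
  on the Hilbert space.\<close>

lemma left_act_vector_functional:
  assumes \<xi>: "\<xi> \<in> bidual T"
  shows "left_act T \<xi> (vf h k) = vf (act \<xi> h) k"
proof (rule dual_eqI)
  fix a
  assume a: "a \<in> T"
  have "right_act T (vf h k) a = vf h (blinfun_apply (adj a) k)"
  proof (rule dual_eqI)
    show "right_act T (vf h k) a b = vf h (blinfun_apply (adj a) k) b" if "b \<in> T" for b
      using a that by (simp add: right_act_def vector_functional_apply cinner_adj in_BH)
  qed (use a in simp_all)
  then show "left_act T \<xi> (vf h k) a = vf (act \<xi> h) k a"
    using a \<xi> by (simp add: left_act_def vector_functional_apply bidual_act cinner_adj in_BH)
qed (use \<xi> in simp_all)

lemma left_act_embed_vector_functional:
  assumes "t \<in> T"
  shows "left_act T (embed T t) (vf h k) = vf (blinfun_apply t h) k"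
proof (rule dual_eqI)
  show "left_act T (embed T t) (vf h k) a = vf (blinfun_apply t h) k a" if "a \<in> T" for a
    using assms that by (simp add: left_act_embed vector_functional_apply)
qed (use assms in simp_all)

lemma functional_adj_vector_functional: "functional_adj T (vf h k) = vf k h"
proof (rule dual_eqI)
  fix a
  assume a: "a \<in> T"
  then show "functional_adj T (vf h k) a = vf k h a"
    using cinner_commute[of "blinfun_apply a k" h]
    by (simp add: functional_adj_def vector_functional_apply cinner_adj_left in_BH)
qed simp_all

lemma star_vector_functional:
  assumes "\<xi> \<in> bidual T"
  shows "bidual_star T \<xi> (vf h k) = cinner h (act \<xi> k)"
  unfolding cinner_commute[of h "act \<xi> k"] bidual_act[OF assms, symmetric]
  by (simp add: bidual_star_apply functional_adj_vector_functional)

text \<open>The involution of the bidual acts as the Hilbert space adjoint, which produces the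
  squared norm. Positivity and the left kernel of a multiple of a vector state are read off from
  this formula.\<close>

lemma star_mult_self_vector_functional:
  assumes "\<xi> \<in> bidual T"
  shows "(bidual_star T \<xi> \<star> \<xi>) (vf k k) = complex_of_real ((norm (act \<xi> k))\<^sup>2)"
  using assms
  by (simp add: arens_mult_apply left_act_vector_functional star_vector_functional cinner_self)

lemma positive_evaluation_vector_functional:
  assumes "0 \<le> c"
  shows "positive_functional T (evaluation T (complex_of_real c *\<^sub>C vf k k))"
  unfolding positive_functional_def
proof
  fix \<xi>
  assume \<xi>: "\<xi> \<in> bidual T"
  have "(bidual_star T \<xi> \<star> \<xi>) (complex_of_real c *\<^sub>C vf k k)
      = complex_of_real (c * (norm (act \<xi> k))\<^sup>2)"
    unfolding bidual_scale[OF arens_in_bidual[OF bidual_star_in_bidual[OF \<xi>] \<xi>] vector_functional_in_dual]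
    by (simp add: star_mult_self_vector_functional[OF \<xi>])
  moreover have "complex_of_real (c * (norm (act \<xi> k))\<^sup>2) \<in> \<real>\<^sub>\<ge>\<^sub>0"
    using assms by (subst nonneg_Reals_of_real_iff) simp
  ultimately show "evaluation T (complex_of_real c *\<^sub>C vf k k) (bidual_star T \<xi> \<star> \<xi>) \<in> \<real>\<^sub>\<ge>\<^sub>0"
    using \<xi> by simp
qed

lemma left_kernel_evaluation_vector_functional:
  assumes "c \<noteq> 0"
  shows "left_kernel T (evaluation T (complex_of_real c *\<^sub>C vf k k)) = {\<xi> \<in> bidual T. act \<xi> k = 0}"
  unfolding left_kernel_def
  by (rule Collect_cong)
    (use assms in \<open>auto simp: bidual_scale star_mult_self_vector_functional\<close>)

lemma left_kernel_evaluation_zero: "left_kernel T (evaluation T 0) = bidual T"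
  by (auto simp: left_kernel_def bidual_zero)


section \<open>Uniqueness of the polar decomposition\<close>

lemma star_add: "bidual_star T (\<xi> + \<eta>) = bidual_star T \<xi> + bidual_star T \<eta>"
  by (simp add: bidual_star_def flip: zero_ext_add)

lemma star_scaleC: "bidual_star T (c *\<^sub>C \<xi>) = cnj c *\<^sub>C bidual_star T \<xi>"
  by (simp add: bidual_star_def flip: zero_ext_scaleC)

lemma star_one: "bidual_star T (bidual_one T) = bidual_one T"
  by (simp add: bidual_one_def star_embed adj_id)

lemma arens_add_left: "(\<xi> + \<eta>) \<star> \<zeta> = \<xi> \<star> \<zeta> + \<eta> \<star> \<zeta>"
  by (simp add: arens_mult_def flip: zero_ext_add)

lemma arens_scaleC_left: "(c *\<^sub>C \<xi>) \<star> \<zeta> = c *\<^sub>C (\<xi> \<star> \<zeta>)"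
  by (simp add: arens_mult_def flip: zero_ext_scaleC)

lemma arens_add_right:
  "\<xi> \<in> bidual T \<Longrightarrow> \<eta> \<in> bidual T \<Longrightarrow> \<zeta> \<in> bidual T \<Longrightarrow> \<xi> \<star> (\<eta> + \<zeta>) = \<xi> \<star> \<eta> + \<xi> \<star> \<zeta>"
  by (rule bidual_eqI) (simp_all add: arens_mult_apply left_act_add_bidual bidual_add)

lemma arens_scaleC_right:
  "\<xi> \<in> bidual T \<Longrightarrow> \<eta> \<in> bidual T \<Longrightarrow> \<xi> \<star> (c *\<^sub>C \<eta>) = c *\<^sub>C (\<xi> \<star> \<eta>)"
  by (rule bidual_eqI) (simp_all add: arens_mult_apply left_act_scaleC_bidual bidual_scale)

text \<open>Expanding \<open>p((\<eta> + l)\<^sup>* (\<eta> + l)) \<ge> 0\<close> for all scalars \<open>l\<close> replaces the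
  Cauchy-Schwarz inequality, which would require \<open>(\<xi> \<eta>)\<^sup>* = \<eta>\<^sup>* \<xi>\<^sup>*\<close>, i.e. Arens regularity.\<close>

lemma positive_functional_vanishes_on_left_kernel:
  assumes lin: "clinear_on (bidual T) p" and pos: "positive_functional T p"
    and \<eta>: "\<eta> \<in> left_kernel T p"
  shows "p \<eta> = 0"
proof -
  let ?one = "bidual_one T"
  have \<eta>': "\<eta> \<in> bidual T" and null: "p (bidual_star T \<eta> \<star> \<eta>) = 0"
    using \<eta> by (auto simp: left_kernel_def)
  define a where "a = p (bidual_star T \<eta>)"
  define b where "b = p \<eta>"
  define d where "d = p ?one"
  have add: "\<And>\<xi> \<zeta>. \<xi> \<in> bidual T \<Longrightarrow> \<zeta> \<in> bidual T \<Longrightarrow> p (\<xi> + \<zeta>) = p \<xi> + p \<zeta>"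
    and scale: "\<And>c \<xi>. \<xi> \<in> bidual T \<Longrightarrow> p (c *\<^sub>C \<xi>) = c * p \<xi>"
    using lin by (auto simp: clinear_on_def)
  have nonneg: "l * a + cnj l * (b + l * d) \<in> \<real>\<^sub>\<ge>\<^sub>0" for l
  proof -
    let ?z = "\<eta> + l *\<^sub>C ?one"
    have "bidual_star T ?z \<star> ?z = bidual_star T \<eta> \<star> \<eta> + l *\<^sub>C bidual_star T \<eta> + cnj l *\<^sub>C (\<eta> + l *\<^sub>C ?one)"
      using \<eta>' by (simp add: star_add star_scaleC star_one arens_add_left arens_scaleC_left
          arens_add_right arens_scaleC_right arens_one_left arens_one_right)
    then have "p (bidual_star T ?z \<star> ?z) = l * a + cnj l * (b + l * d)"
      using \<eta>' null by (simp add: add scale a_def b_def d_def)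
    moreover have "p (bidual_star T ?z \<star> ?z) \<in> \<real>\<^sub>\<ge>\<^sub>0"
      using pos \<eta>' by (simp add: positive_functional_def)
    ultimately show ?thesis
      by simp
  qed
  have "p (bidual_star T ?one \<star> ?one) \<in> \<real>\<^sub>\<ge>\<^sub>0"
    using pos by (simp add: positive_functional_def)
  then have d: "Re d \<ge> 0" "Im d = 0"
    by (simp_all add: star_one arens_one_left d_def complex_nonneg_Reals_iff)
  have "a = cnj b"
    \<comment> \<open>As \<open>d\<close> is real, vanishing of the imaginary parts gives
      \<open>Im (a + b) = 0\<close> for \<open>l = 1\<close> and \<open>Re (a - b) = 0\<close> for
      \<open>l = \<i>\<close>.\<close>
    using nonneg[of 1] nonneg[of \<i>] d by (auto simp: complex_nonneg_Reals_iff complex_eq_iff)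
  have "cnj b = 0"
  proof (rule quadratic_nonneg_imp_zero[OF _ d(1)])
    show "0 \<le> 2 * Re (l * cnj b) + (cmod l)\<^sup>2 * Re d" for l
      using nonneg[of l] d unfolding \<open>a = cnj b\<close> cmod_power2
      by (simp add: complex_nonneg_Reals_iff algebra_simps power2_eq_square)
  qed
  then show ?thesis
    by (simp add: b_def)
qed

text \<open>Write \<open>\<xi>\<close> as \<open>\<xi>(I - v\<^sup>*v)\<close> plus
  \<open>\<xi>v\<^sup>*v\<close>. The first summand lies in the left kernel of \<open>p\<close>,
  where \<open>p\<close> vanishes; on the second, \<open>p\<close> is given by the extension of
  \<phi>. Hence \<open>v\<close> determines \<open>p\<close>.\<close>

lemma polar_decomposition_functional:
  assumes \<phi>: "\<phi> \<in> dual T" and polar: "polar_decomposition T \<phi> v p" and \<xi>: "\<xi> \<in> bidual T"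
  shows "p \<xi> = \<xi> (left_act T (bidual_star T v) \<phi>)"
proof -
  let ?s = "bidual_star T v"
  have v: "v \<in> bidual T" and lin: "clinear_on (bidual T) p" and pos: "positive_functional T p"
    and eq: "\<And>\<xi>. \<xi> \<in> bidual T \<Longrightarrow> normal_ext T \<phi> \<xi> = p (\<xi> \<star> v)"
    and ker: "\<And>\<xi>. \<xi> \<in> bidual T \<Longrightarrow> \<xi> \<star> (bidual_one T - ?s \<star> v) \<in> left_kernel T p"
    using polar by (auto simp: polar_decomposition_def partial_isometry_def normal_functionals_def)
  have "p (\<xi> \<star> (bidual_one T - ?s \<star> v)) = 0"
    by (rule positive_functional_vanishes_on_left_kernel[OF lin pos ker[OF \<xi>]])
  moreover have "\<xi> = \<xi> \<star> (bidual_one T - ?s \<star> v) + (\<xi> \<star> ?s) \<star> v"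
    using v \<xi> by (simp add: arens_diff_right arens_assoc arens_one_right)
  ultimately have "p \<xi> = p ((\<xi> \<star> ?s) \<star> v)"
    using lin v \<xi> unfolding clinear_on_def
    by (metis add.left_neutral arens_in_bidual bidual_closed(4) bidual_star_in_bidual one_in_bidual)
  also have "\<dots> = (\<xi> \<star> ?s) \<phi>"
    using eq[of "\<xi> \<star> ?s"] \<phi> v \<xi> by (simp add: normal_ext_eq_evaluation)
  finally show ?thesis
    using \<phi> by (simp add: arens_mult_apply)
qed

end

section \<open>Algebras containing the compact operators\<close>

locale operator_cstar_algebra_with_compacts = operator_cstar_algebra +
  assumes compacts: "compact_operators \<subseteq> T"
begin

lemma rank_one_in [simp]: "rank_one x y \<in> T"
  using compacts rank_one_compact by blast

lemma dual_norm_vector_functional: "dual_norm T (vf h k) = norm h * norm k"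
proof (rule antisym[OF dual_norm_vector_functional_le])
  show "norm h * norm k \<le> dual_norm T (vf h k)"
  proof (cases "h = 0 \<or> k = 0")
    case True
    then show ?thesis
      using dual_norm_nonneg[OF vector_functional_in_dual[of h k]] by auto
  next
    case False
    \<comment> \<open>The rank-one operator sending \<open>h\<close> to a multiple of
      \<open>k\<close> attains the norm, up to scaling.\<close>
    have "(norm h * norm k)\<^sup>2 = cmod (vf h k (rank_one k h))"
      by (simp add: vector_functional_apply cinner_scaleC_left cinner_self norm_mult norm_power
          power_mult_distrib)
    also have "\<dots> \<le> dual_norm T (vf h k) * norm (rank_one k h)"
      by (intro dual_bound) simp_all
    also have "\<dots> \<le> dual_norm T (vf h k) * (norm k * norm h)"
      by (intro mult_left_mono norm_rank_one_le dual_norm_nonneg) simp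
    finally have "(norm h * norm k) * (norm h * norm k) \<le> dual_norm T (vf h k) * (norm h * norm k)"
      by (simp add: power2_eq_square mult_ac)
    moreover have "norm h * norm k > 0"
      using False by simp
    ultimately show ?thesis
      by (rule mult_right_le_imp_le)
  qed
qed

text \<open>By the preceding formula \<open>p\<close> is evaluation at \<open>vf z k\<close>, where
  \<open>z\<close> is the adjoint of \<open>v\<close> applied to \<open>h\<close>. Positivity on
  rank-one operators forces \<open>z\<close> to be a nonnegative multiple of \<open>k\<close>, and
  \<open>h = act v z\<close> then forces \<open>norm z = norm h\<close>.\<close>

lemma vector_functional_polar_unique:
  assumes polar: "polar_decomposition T (vf h k) v p"
  shows "p = evaluation T (complex_of_real (norm h / norm k) *\<^sub>C vf k k)"
proof -
  have v: "v \<in> bidual T" and normal: "p \<in> normal_functionals T" and pos: "positive_functional T p"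
    and eq: "\<And>\<xi>. \<xi> \<in> bidual T \<Longrightarrow> normal_ext T (vf h k) \<xi> = p (\<xi> \<star> v)"
    using polar by (auto simp: polar_decomposition_def partial_isometry_def)
  define z where "z = act (bidual_star T v) h"
  have p: "p \<xi> = \<xi> (vf z k)" if "\<xi> \<in> bidual T" for \<xi>
    using polar_decomposition_functional[OF _ polar that] v
    by (simp add: left_act_vector_functional z_def)
  have "vf z k = complex_of_real (norm h / norm k) *\<^sub>C vf k k"
  proof (cases "k = 0")
    case False
    define K where "K = (norm k)\<^sup>2"
    define \<alpha> where "\<alpha> = cinner z k / of_real K"
    define w where "w = z - \<alpha> *\<^sub>C k"
    define W where "W = (norm w)\<^sup>2"
    have K: "K > 0" "cinner k k = of_real K"
      using False by (simp_all add: K_def cinner_self)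
    have wk: "cinner w k = 0" "cinner k w = 0"
      using K cinner_commute[of k w] by (simp_all add: w_def cinner_diff_left cinner_scaleC_left \<alpha>_def)
    have z: "z = w + \<alpha> *\<^sub>C k"
      by (simp add: w_def)
    \<comment> \<open>This is positivity of \<open>p\<close> at the square of the embedded rank-one
      operator \<open>rank_one k x\<close>.\<close>
    have form: "cinner z x * cinner x k * of_real K \<in> \<real>\<^sub>\<ge>\<^sub>0" for x
    proof -
      let ?t = "rank_one k x"
      have "p (bidual_star T (embed T ?t) \<star> embed T ?t) = cinner (blinfun_apply (adj ?t o\<^sub>L ?t) z) k"
        by (simp add: star_embed arens_embed p embed_apply vector_functional_apply adj_rank_one)
      also have "\<dots> = cinner z x * cinner x k * of_real K"
        by (simp add: adj_rank_one cinner_scaleC_left K)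
      finally show ?thesis
        using pos embed_in_bidual[OF rank_one_in, of k x] unfolding positive_functional_def by metis
    qed
    \<comment> \<open>Here \<open>form\<close> is applied to \<open>w + s *\<^sub>C k\<close>, with
      \<open>w\<close> the component of \<open>z\<close> orthogonal to \<open>k\<close>, and divided
      by the positive number \<open>K * K\<close>.\<close>
    have quad: "s * of_real W + s * cnj s * \<alpha> * of_real K \<in> \<real>\<^sub>\<ge>\<^sub>0" for s
    proof -
      have "cinner z (w + s *\<^sub>C k) * cinner (w + s *\<^sub>C k) k * of_real K
          = of_real (K * K) * (s * of_real W + s * cnj s * \<alpha> * of_real K)"
        unfolding z
        by (simp add: cinner_add_left cinner_add_right cinner_scaleC_left cinner_scaleC_right wk K
            cinner_self[of w] W_def algebra_simps)
      then have "of_real (K * K) * (s * of_real W + s * cnj s * \<alpha> * of_real K) \<in> \<real>\<^sub>\<ge>\<^sub>0"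
        using form[of "w + s *\<^sub>C k"] by metis
      moreover have "of_real (1 / (K * K)) \<in> (\<real>\<^sub>\<ge>\<^sub>0 :: complex set)"
        using K by (subst nonneg_Reals_of_real_iff) simp
      ultimately have "of_real (1 / (K * K))
          * (of_real (K * K) * (s * of_real W + s * cnj s * \<alpha> * of_real K)) \<in> \<real>\<^sub>\<ge>\<^sub>0"
        by (rule nonneg_Reals_mult_I[rotated])
      then show ?thesis
        using K by simp
    qed
    \<comment> \<open>The value \<open>s = 1\<close> makes \<alpha> real, and
      \<open>s = \<i>\<close> then isolates \<open>W\<close>, so \<open>w = 0\<close>; the
      inequality that remains gives the sign of \<alpha>.\<close>
    have "Im \<alpha> * K = 0" "W + Im \<alpha> * K = 0" "W + Re \<alpha> * K \<ge> 0"
      using quad[of 1] quad[of \<i>] by (simp_all add: complex_nonneg_Reals_iff)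
    then have "W = 0" "Im \<alpha> = 0" "Re \<alpha> \<ge> 0"
      using K by (auto simp: zero_le_mult_iff)
    then have zk: "z = of_real (Re \<alpha>) *\<^sub>C k"
      using complex_is_Real_iff[of \<alpha>] by (simp add: z W_def complex_eq_iff)
    \<comment> \<open>Comparing the two expressions for the extension at \<open>rank_one k x\<close>
      determines \<open>h\<close> through its inner products, as \<open>k\<close> is
      nonzero.\<close>
    have "h = act v z"
    proof (rule cinner_ext)
      fix x
      have "cinner h x * of_real K = embed T (rank_one k x) (vf h k)"
        by (simp add: embed_apply vector_functional_apply cinner_scaleC_left K)
      also have "\<dots> = p (embed T (rank_one k x) \<star> v)"
        using eq[of "embed T (rank_one k x)"] by (simp add: normal_ext_eq_evaluation)
      also have "\<dots> = embed T (rank_one k x) (vf (act v z) k)"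
        using v by (simp add: p arens_mult_apply left_act_vector_functional)
      also have "\<dots> = cinner (act v z) x * of_real K"
        by (simp add: embed_apply vector_functional_apply cinner_scaleC_left K)
      finally show "cinner x h = cinner x (act v z)"
        unfolding cinner_commute[of x h] cinner_commute[of x "act v z"] using K by simp
    qed
    moreover have "cinner z y = cinner h (act v y)" for y
      using v by (simp add: z_def star_vector_functional flip: bidual_act)
    \<comment> \<open>Take \<open>y = z\<close> in the adjoint relation and use
      \<open>act v z = h\<close>.\<close>
    ultimately have "cinner z z = cinner h h"
      by metis
    then have "norm h = norm z"
      unfolding cinner_self of_real_eq_iff by simp
    also have "\<dots> = Re \<alpha> * norm k"
      using \<open>Re \<alpha> \<ge> 0\<close> by (simp add: zk norm_scaleC)
    finally have "Re \<alpha> = norm h / norm k"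
      using False by simp
    then show ?thesis
      by (simp add: zk vector_functional_scaleC_left)
  qed simp
  show ?thesis
  proof
    fix \<xi>
    show "p \<xi> = evaluation T (complex_of_real (norm h / norm k) *\<^sub>C vf k k) \<xi>"
    proof (cases "\<xi> \<in> bidual T")
      case True
      then show ?thesis
        by (simp only: p \<open>vf z k = _\<close> evaluation_apply)
    next
      case False
      then show ?thesis
        using normal by (simp add: normal_functionals_def evaluation_def)
    qed
  qed
qed


section \<open>Polar decomposition of vector functionals\<close>

lemma polar_decomposition_zero: "polar_decomposition T 0 0 (evaluation T 0)"
proof -
  have [simp]: "0 \<star> \<xi> = 0" for \<xi>
    by (auto simp: arens_mult_def zero_ext_def)
  have star: "bidual_star T 0 = 0"
    by (auto simp: bidual_star_def zero_ext_def)
  show ?thesis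
    unfolding polar_decomposition_def partial_isometry_def left_kernel_evaluation_zero star
    by (auto simp: evaluation_normal normal_ext_eq_evaluation bidual_zero positive_functional_def
        arens_one_right) (metis arens_one_right)
qed

text \<open>Since \<open>a o\<^sub>L rank_one x w\<close> is \<open>rank_one\<close> of
  \<open>a x\<close> and \<open>w\<close>, only the functional
  \<open>u \<mapsto> \<phi> (rank_one u w)\<close> matters, and the Riesz theorem represents it.
  Consequently an element of the bidual multiplied on the right by a rank-one operator is governed
  by its action on the Hilbert space.\<close>

lemma left_act_embed_rank_one:
  assumes \<phi>: "\<phi> \<in> dual T"
  shows "\<exists>y. left_act T (embed T (rank_one x w)) \<phi> = vf x y"
proof -
  have "\<exists>y. \<forall>u. \<phi> (rank_one u w) = cinner u y"
  proof (rule Riesz_representation[where K = "dual_norm T \<phi> * norm w"])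
    show "cmod (\<phi> (rank_one u w)) \<le> dual_norm T \<phi> * norm w * norm u" for u
    proof -
      have "cmod (\<phi> (rank_one u w)) \<le> dual_norm T \<phi> * norm (rank_one u w)"
        by (intro dual_bound \<phi>) simp
      also have "\<dots> \<le> dual_norm T \<phi> * (norm u * norm w)"
        by (intro mult_left_mono norm_rank_one_le dual_norm_nonneg \<phi>)
      finally show ?thesis
        by (simp add: mult_ac)
    qed
  qed (simp_all add: rank_one_add rank_one_scaleC dual_add[OF \<phi>] dual_scale[OF \<phi>])
  then obtain y where y: "\<And>u. \<phi> (rank_one u w) = cinner u y"
    by blast
  have "left_act T (embed T (rank_one x w)) \<phi> = vf x y"
    unfolding left_act_embed[OF rank_one_in \<phi>] vector_functional_def
    by (rule zero_ext_eqI) (simp add: compose_rank_one in_BH y)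
  then show ?thesis
    by blast
qed

text \<open>The partial isometry is the rank-one operator taking the unit vector \<open>w\<close>
  along \<open>k\<close> to the unit vector \<open>u\<close> along \<open>h\<close>. Its initial
  projection is \<open>rank_one w w\<close>, so the left kernel condition says that
  \<open>\<xi>\<close> kills \<open>k\<close> exactly when it kills this projection.\<close>

lemma polar_decomposition_vector_functional:
  assumes "h \<noteq> 0" "k \<noteq> 0"
  shows "\<exists>v. polar_decomposition T (vf h k) v
    (evaluation T (complex_of_real (norm h / norm k) *\<^sub>C vf k k))"
proof -
  define u where "u = complex_of_real (1 / norm h) *\<^sub>C h"
  define w where "w = complex_of_real (1 / norm k) *\<^sub>C k"
  define c where "c = norm h / norm k"
  define v where "v = embed T (rank_one u w)"
  let ?p = "evaluation T (complex_of_real c *\<^sub>C vf k k)"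
  let ?e = "embed T (rank_one w w)"
  have c: "c > 0"
    using assms by (simp add: c_def)
  have "norm u = 1" "norm w = 1"
    using assms by (simp_all add: u_def w_def norm_scaleC norm_divide)
  then have unit: "cinner u u = 1" "cinner w w = 1"
    by (simp_all add: cinner_self)
  have kw: "k = complex_of_real (norm k) *\<^sub>C w" and hu: "h = complex_of_real (norm h) *\<^sub>C u"
    using assms by (simp_all add: u_def w_def scaleC_scaleC scaleC_one)
  have v: "v \<in> bidual T"
    by (simp add: v_def)
  have vv: "bidual_star T v \<star> v = ?e"
    by (simp add: v_def star_embed adj_rank_one arens_embed compose_rank_one rank_one_in_BH unit
        scaleC_one)
  have "partial_isometry T v"
    using v unfolding partial_isometry_def vv
    by (simp add: v_def arens_embed compose_rank_one rank_one_in_BH unit scaleC_one)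
  moreover have "?p \<in> normal_functionals T"
    by (simp add: evaluation_normal)
  moreover have "positive_functional T ?p"
    using c by (intro positive_evaluation_vector_functional) simp
  moreover have "normal_ext T (vf h k) \<xi> = ?p (\<xi> \<star> v)" if \<xi>: "\<xi> \<in> bidual T" for \<xi>
  proof -
    have "h = complex_of_real c *\<^sub>C blinfun_apply (rank_one u w) k"
    proof -
      have "cinner k w = of_real (norm k)"
        by (subst kw) (simp add: cinner_scaleC_left unit)
      then show ?thesis
        using assms hu by (simp add: c_def scaleC_scaleC)
    qed
    then have "vf h k = complex_of_real c *\<^sub>C left_act T v (vf k k)"
      by (metis left_act_embed_vector_functional rank_one_in v_def vector_functional_scaleC_left)
    then show ?thesis
      using \<xi> v by (simp add: normal_ext_eq_evaluation bidual_scale arens_mult_apply)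
  qed
  moreover have "{\<xi> \<star> (bidual_one T - bidual_star T v \<star> v) |\<xi>. \<xi> \<in> bidual T} = left_kernel T ?p"
    unfolding vv left_kernel_evaluation_vector_functional[OF less_imp_neq[OF c, symmetric]]
  proof safe
    fix \<xi>
    assume \<xi>: "\<xi> \<in> bidual T"
    then show mem: "\<xi> \<star> (bidual_one T - ?e) \<in> bidual T"
      by simp
    have "blinfun_apply (rank_one w w) k = k"
      by (subst (1 2) kw) (simp add: blinfun.scaleR_right cinner_scaleC_left unit)
    then have "left_act T (bidual_one T - ?e) (vf k y) = 0" for y
      by (simp add: left_act_diff_bidual left_act_one left_act_embed_vector_functional)
    then show "act (\<xi> \<star> (bidual_one T - ?e)) k = 0"
      using \<xi> by (simp add: bidual_act_eq_zero_iff[OF mem] arens_mult_apply bidual_zero)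
  next
    fix \<xi>
    assume \<xi>: "\<xi> \<in> bidual T" and "act \<xi> k = 0"
    then have zero: "\<xi> (vf w y) = 0" for y
      unfolding w_def by (simp add: vector_functional_scaleC_left bidual_scale bidual_act_eq_zero_iff)
    \<comment> \<open>Every functional \<open>?e \<cdot> \<phi>\<close> is a vector functional
      \<open>vf w y\<close>, on which \<open>\<xi>\<close> vanishes because \<open>\<xi>\<close>
      kills \<open>k\<close>.\<close>
    have "\<xi> \<star> ?e = 0"
    proof (rule bidual_eqI)
      fix \<phi>
      assume \<phi>: "\<phi> \<in> dual T"
      then show "(\<xi> \<star> ?e) \<phi> = 0 \<phi>"
        using left_act_embed_rank_one[OF \<phi>, of w w] zero by (auto simp: arens_mult_apply)
    qed (use \<xi> in simp_all)
    then have "\<xi> = \<xi> \<star> (bidual_one T - ?e)"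
      using \<xi> by (simp add: arens_diff_right arens_one_right)
    then show "\<exists>\<zeta>. \<xi> = \<zeta> \<star> (bidual_one T - ?e) \<and> \<zeta> \<in> bidual T"
      using \<xi> by blast
  qed
  ultimately have "polar_decomposition T (vf h k) v ?p"
    unfolding polar_decomposition_def by blast
  then show ?thesis
    unfolding c_def by blast
qed

lemma abs_normal_vector_functional:
  "abs_normal T (vf h k) = evaluation T (complex_of_real (norm h / norm k) *\<^sub>C vf k k)"
proof -
  have "\<exists>v. polar_decomposition T (vf h k) v
    (evaluation T (complex_of_real (norm h / norm k) *\<^sub>C vf k k))"
  proof (cases "h = 0 \<or> k = 0")
    \<comment> \<open>Both sides degenerate to zero: for \<open>k = 0\<close> the vector functional
      on the right is already zero, and for \<open>h = 0\<close> its coefficient is.\<close>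
    case True
    then show ?thesis
      using polar_decomposition_zero by auto
  qed (use polar_decomposition_vector_functional in blast)
  then show ?thesis
    unfolding abs_normal_def using vector_functional_polar_unique by (intro the_equality) auto
qed

lemma abs_functional_vector_functional:
  "abs_functional T (vf h k) = complex_of_real (norm h / norm k) *\<^sub>C vf k k"
proof -
  let ?\<psi> = "complex_of_real (norm h / norm k) *\<^sub>C vf k k"
  have \<psi>: "?\<psi> \<in> dual T"
    by simp
  have "zero_ext T (\<lambda>t. evaluation T ?\<psi> (embed T t)) = zero_ext T ?\<psi>"
    by (rule zero_ext_eqI) (simp only: evaluation_apply embed_in_bidual embed_apply[OF \<psi>])
  also have "\<dots> = ?\<psi>"
    by (rule zero_ext_dual[OF \<psi>])
  finally show ?thesis
    unfolding abs_functional_def abs_normal_vector_functional .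
qed

end


section \<open>Vector states in the band\<close>

lemma csubspace_closure:
  fixes M :: "'a::chilbert_space set"
  assumes "csubspace M"
  shows "csubspace (closure M)"
  unfolding csubspace_def
proof (intro conjI ballI allI)
  show "0 \<in> closure M"
    using assms closure_subset by (auto simp: csubspace_def)
next
  fix x y
  assume "x \<in> closure M" "y \<in> closure M"
  then obtain a b where ab: "\<And>n. a n \<in> M" "a \<longlonglongrightarrow> x" "\<And>n. b n \<in> M" "b \<longlonglongrightarrow> y"
    unfolding closure_sequential by blast
  have "(\<lambda>n. a n + b n) \<longlonglongrightarrow> x + y"
    by (intro tendsto_add ab)
  moreover have "\<And>n. a n + b n \<in> M"
    using ab assms by (simp add: csubspace_def)
  ultimately show "x + y \<in> closure M"
    unfolding closure_sequential by (intro exI[of _ "\<lambda>n. a n + b n"]) simp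
next
  fix c x
  assume "x \<in> closure M"
  then obtain a where a: "\<And>n. a n \<in> M" "a \<longlonglongrightarrow> x"
    unfolding closure_sequential by blast
  have "bounded_linear (\<lambda>x::'a. c *\<^sub>C x)"
    by (rule bounded_linear_intro[where K = "cmod c"])
      (simp_all add: scaleC_add_right scaleR_scaleC scaleC_scaleC norm_scaleC mult.commute)
  then have "(\<lambda>n. c *\<^sub>C a n) \<longlonglongrightarrow> c *\<^sub>C x"
    by (rule bounded_linear.tendsto) (rule a)
  moreover have "\<And>n. c *\<^sub>C a n \<in> M"
    using a assms by (simp add: csubspace_def)
  ultimately show "c *\<^sub>C x \<in> closure M"
    unfolding closure_sequential by (intro exI[of _ "\<lambda>n. c *\<^sub>C a n"]) simp
qed

text \<open>The orbit of \<open>x\<close> under the adjoints is a subspace whose closure is proper,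
  so some nonzero \<open>y\<close> is orthogonal to it. Passing to the other side of the inner
  product, the functional of \<open>y\<close> and \<open>x\<close> annihilates
  \<open>A\<close>.\<close>

lemma non_cyclic_obtains_vector:
  fixes A :: "'h::chilbert_space op set"
  assumes A: "A \<subseteq> BH" "csubspace A" and x: "\<not> cyclic_vector (adj ` A) x"
  obtains y where "y \<noteq> 0" "\<And>a. a \<in> A \<Longrightarrow> cinner (blinfun_apply a y) x = 0"
proof -
  define M where "M = {blinfun_apply s x |s. s \<in> adj ` A}"
  have "csubspace M"
    unfolding csubspace_def
  proof (intro conjI ballI allI)
    have "adj (0 :: 'h op) = 0"
      by (rule adj_eqI) simp
    then have "0 = blinfun_apply (adj (0 :: 'h op)) x"
      by simp
    then show "0 \<in> M"
      using A by (force simp: M_def csubspace_def)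
  next
    fix u v
    assume "u \<in> M" "v \<in> M"
    then obtain a b where ab: "a \<in> A" "b \<in> A" "u = blinfun_apply (adj a) x" "v = blinfun_apply (adj b) x"
      by (auto simp: M_def)
    then have "u + v = blinfun_apply (adj (a + b)) x"
      using A by (simp add: adj_add subsetD blinfun.add_left)
    moreover have "a + b \<in> A"
      using ab A by (simp add: csubspace_def)
    ultimately show "u + v \<in> M"
      by (auto simp: M_def)
  next
    fix c u
    assume "u \<in> M"
    then obtain a where a: "a \<in> A" "u = blinfun_apply (adj a) x"
      by (auto simp: M_def)
    \<comment> \<open>The scalar is conjugated because \<open>adj\<close> is
      conjugate-linear.\<close>
    then have "c *\<^sub>C u = blinfun_apply (adj (cnj c *\<^sub>C a)) x"
      using A by (simp add: adj_scaleC subsetD)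
    moreover have "cnj c *\<^sub>C a \<in> A"
      using a A by (simp add: csubspace_def)
    ultimately show "c *\<^sub>C u \<in> M"
      by (auto simp: M_def)
  qed
  moreover have "closure M \<noteq> UNIV"
    using x by (simp add: cyclic_vector_def M_def)
  ultimately obtain y where y: "y \<noteq> 0" "\<And>m. m \<in> closure M \<Longrightarrow> cinner m y = 0"
    using exists_orthogonal_vector[OF csubspace_closure closed_closure] by blast
  have "cinner (blinfun_apply a y) x = 0" if a: "a \<in> A" for a
  proof -
    have "blinfun_apply (adj a) x \<in> closure M"
      using a closure_subset[of M] by (auto simp: M_def)
    then have "cinner (blinfun_apply (adj a) x) y = 0"
      by (rule y(2))
    then have "cinner x (blinfun_apply a y) = 0"
      using a A by (simp add: cinner_adj_left subsetD)
    then show ?thesis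
      unfolding cinner_commute[of "blinfun_apply a y"] by simp
  qed
  with y(1) show ?thesis
    by (rule that)
qed

section \<open>Approximation of vector states by generators of the band\<close>

context operator_cstar_algebra_with_compacts
begin

lemma vector_state_scale:
  "vf (complex_of_real r *\<^sub>C x) (complex_of_real r *\<^sub>C x) = complex_of_real (r\<^sup>2) *\<^sub>C vf x x"
  by (simp add: vector_functional_scaleC_left vector_functional_scaleC_right scaleC_scaleC
      power2_eq_square)

lemma vector_state_in_generators:
  assumes "A \<subseteq> T" "x \<noteq> 0" "y \<noteq> 0" and orth: "\<And>a. a \<in> A \<Longrightarrow> cinner (blinfun_apply a y) x = 0"
  shows "vf (complex_of_real (1 / norm x) *\<^sub>C x) (complex_of_real (1 / norm x) *\<^sub>C x)
    \<in> abs_functional T ` {\<phi> \<in> annihilator T A. dual_norm T \<phi> = 1}"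
proof -
  \<comment> \<open>The scaling gives \<open>norm y' = 1 / norm x\<close>. Then
    \<open>vf y' x\<close> has dual norm 1, and the coefficient \<open>norm y' / norm x\<close> of
    its absolute value is exactly what normalizes \<open>vf x x\<close>.\<close>
  define y' where "y' = complex_of_real (1 / (norm x * norm y)) *\<^sub>C y"
  have norm: "norm y' = 1 / norm x"
    using assms by (simp add: y'_def norm_scaleC norm_divide norm_mult)
  have "vf y' x a = 0" if "a \<in> A" for a
    using that assms(1) orth[OF that]
    by (simp add: y'_def vector_functional_scaleC_left vector_functional_apply subsetD)
  moreover have "dual_norm T (vf y' x) = 1"
    using norm assms by (simp add: dual_norm_vector_functional)
  moreover have "abs_functional T (vf y' x)
      = vf (complex_of_real (1 / norm x) *\<^sub>C x) (complex_of_real (1 / norm x) *\<^sub>C x)"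
    unfolding abs_functional_vector_functional vector_state_scale norm
    by (simp add: power2_eq_square)
  ultimately show ?thesis
    by (intro rev_image_eqI[of "vf y' x"]) (simp_all add: annihilator_def)
qed

text \<open>Change one argument at a time: insert the mixed term
  \<open>\<langle>tu, w\<rangle>\<close>.\<close>

lemma dual_norm_vector_state_diff_le:
  assumes "norm u = 1" "norm w = 1"
  shows "dual_norm T (vf u u - vf w w) \<le> 2 * norm (u - w)"
proof (rule dual_norm_le)
  fix t
  assume t: "t \<in> T"
  have "(vf u u - vf w w) t = cinner (blinfun_apply t u) (u - w) + cinner (blinfun_apply t (u - w)) w"
    using t by (simp add: vector_functional_apply cinner_diff_left cinner_diff_right blinfun.diff_right)
  also have "cmod \<dots> \<le> (norm u * norm (u - w)) * norm t + (norm (u - w) * norm w) * norm t"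
    by (intro norm_triangle_mono vector_functional_bound)
  finally show "cmod ((vf u u - vf w w) t) \<le> 2 * norm (u - w) * norm t"
    using assms by (simp add: mult_ac)
qed simp

lemma vector_state_in_Delta:
  assumes A: "unital_closed_subalgebra A" "A \<subseteq> T" and dense: "closure \<Gamma> = UNIV"
    and non_cyclic: "\<And>x. x \<in> \<Gamma> \<Longrightarrow> \<not> cyclic_vector (adj ` A) x" and u: "norm u = 1"
  shows "vf u u \<in> Delta T A"
  unfolding Delta_def norm_closure_def
proof (intro CollectI conjI allI impI)
  let ?G = "abs_functional T ` {\<phi> \<in> annihilator T A. dual_norm T \<phi> = 1}"
  fix \<epsilon> :: real
  assume \<epsilon>: "\<epsilon> > 0"
  \<comment> \<open>The bound \<open>d < 1\<close> keeps the approximating \<open>x\<close> away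
    from 0. Normalizing at most doubles the error \<open>d\<close>, and passing to states doubles it
    again, whence \<open>4 * d < \<epsilon>\<close>.\<close>
  define d where "d = min (1 / 2) (\<epsilon> / 8)"
  have d: "d > 0" "d < 1" "4 * d < \<epsilon>"
    using \<epsilon> by (auto simp: d_def min_def)
  have A': "A \<subseteq> BH" "csubspace A"
    using A(1) by (simp_all add: unital_closed_subalgebra_def)
  obtain x where x: "x \<in> \<Gamma>" "dist x u < d"
    using dense d(1) closure_approachable[of u \<Gamma>] by auto
  have "norm (u - x) < d"
    using x(2) by (simp add: dist_norm norm_minus_commute)
  then have x0: "x \<noteq> 0"
    using u d by auto
  define w where "w = complex_of_real (1 / norm x) *\<^sub>C x"
  have w: "norm w = 1"
    using x0 by (simp add: w_def norm_scaleC norm_divide)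
  \<comment> \<open>Normalization moves \<open>x\<close> by the difference of \<open>norm x\<close>
    and 1, which is at most \<open>norm (u - x)\<close> because \<open>norm u = 1\<close>.\<close>
  have "x - w = (norm x - 1) *\<^sub>R w"
    unfolding w_def scaleR_scaleC[symmetric] using x0 by (simp add: diff_divide_distrib scaleR_left_diff_distrib)
  then have "norm (x - w) = \<bar>norm x - norm u\<bar>"
    by (simp add: w u)
  also have "\<dots> \<le> norm (u - x)"
    using norm_triangle_ineq3[of x u] by (simp add: norm_minus_commute)
  finally have "norm (u - w) < 2 * d"
    using norm_triangle_ineq[of "u - x" "x - w"] \<open>norm (u - x) < d\<close> by simp
  then have "dual_norm T (vf u u - vf w w) < \<epsilon>"
    using dual_norm_vector_state_diff_le[OF u w] d by linarith
  moreover obtain y where "y \<noteq> 0" "\<And>a. a \<in> A \<Longrightarrow> cinner (blinfun_apply a y) x = 0"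
    by (rule non_cyclic_obtains_vector[OF A' non_cyclic[OF x(1)]]) blast
  then have "vf w w \<in> convex hull ?G"
    unfolding w_def by (intro hull_inc vector_state_in_generators A x0)
  ultimately show "\<exists>\<psi>\<in>convex hull ?G. dual_norm T (vf u u - \<psi>) < \<epsilon>"
    by blast
qed simp

lemma vector_functional_in_AC:
  assumes A: "unital_closed_subalgebra A" "A \<subseteq> T" and dense: "closure \<Gamma> = UNIV"
    and non_cyclic: "\<And>x. x \<in> \<Gamma> \<Longrightarrow> \<not> cyclic_vector (adj ` A) x"
  shows "vf h k \<in> AC T (Delta T A)"
proof -
  have A': "A \<subseteq> BH" "csubspace A"
    using A(1) by (simp_all add: unital_closed_subalgebra_def)
  obtain x where x: "x \<in> \<Gamma>"
    using dense by fastforce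
  obtain y where y: "y \<noteq> 0" "\<And>a. a \<in> A \<Longrightarrow> cinner (blinfun_apply a y) x = 0"
    by (rule non_cyclic_obtains_vector[OF A' non_cyclic[OF x]]) blast
  \<comment> \<open>If \<open>h\<close> or \<open>k\<close> is zero, the functional is zero and
    every vector state dominates it; \<open>y\<close> then provides a nonzero vector, which exists
    because \<Gamma> is nonempty and its elements are non-cyclic.\<close>
  define y' where "y' = (if h = 0 \<or> k = 0 then y else k)"
  define u where "u = complex_of_real (1 / norm y') *\<^sub>C y'"
  have y': "y' \<noteq> 0"
    using y by (simp add: y'_def)
  then have u: "norm u = 1"
    by (simp add: u_def norm_scaleC norm_divide)
  have "y' = complex_of_real (norm y') *\<^sub>C u"
    using y' by (simp add: u_def scaleC_scaleC scaleC_one)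
  then have y'u: "vf y' z = complex_of_real (norm y') *\<^sub>C vf u z" for z
    by (metis vector_functional_scaleC_left)
  have kernel_u: "left_kernel T (abs_normal T (vf u u)) = {\<xi> \<in> bidual T. act \<xi> u = 0}"
    using left_kernel_evaluation_vector_functional[of 1 u] u
    unfolding abs_normal_vector_functional by simp
  have "abs_continuous T (vf h k) (vf u u)"
  proof (cases "h = 0 \<or> k = 0")
    case True
    then have "left_kernel T (abs_normal T (vf h k)) = bidual T"
      unfolding abs_normal_vector_functional by (auto simp: left_kernel_evaluation_zero)
    then show ?thesis
      by (auto simp: abs_continuous_def left_kernel_def)
  next
    case False
    then have "left_kernel T (abs_normal T (vf h k)) = {\<xi> \<in> bidual T. act \<xi> k = 0}"
      unfolding abs_normal_vector_functional
      by (intro left_kernel_evaluation_vector_functional) simp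
    moreover have "act \<xi> k = 0" if "\<xi> \<in> bidual T" "act \<xi> u = 0" for \<xi>
      using that y'u False
      by (simp add: bidual_act_eq_zero_iff bidual_scale y'_def)
    ultimately show ?thesis
      unfolding abs_continuous_def kernel_u by blast
  qed
  moreover have "vf u u \<in> Delta T A"
    by (rule vector_state_in_Delta[OF A dense non_cyclic u])
  ultimately show ?thesis
    unfolding AC_def by auto
qed

end


section \<open>Weak-* convergence of bounded nets\<close>

lemma bounded_net_tendsto_weak_star_BH:
  fixes F :: "'h::chilbert_space op filter"
  assumes bounded: "\<forall>\<^sub>F b in F. norm b \<le> M" and BH: "\<forall>\<^sub>F b in F. b \<in> BH"
    and weak: "\<And>h k. ((\<lambda>b. cinner (blinfun_apply b h) k) \<longlongrightarrow> 0) F"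
  shows "limitin weak_star_BH (\<lambda>b. b) 0 F"
  unfolding weak_star_BH_def
proof (rule limitin_weak_topology)
  show "0 \<in> (BH :: 'h op set)"
    by (simp add: BH_def)
  have "(\<lambda>b. \<Sum>n::nat. cinner (blinfun_apply b (0::'h)) 0) \<in> predual_BH"
    unfolding predual_BH_def mem_Collect_eq
    by (rule exI[of _ "\<lambda>_. 0"], rule exI[of _ "\<lambda>_. 0"]) simp
  then show "predual_BH \<noteq> ({} :: ('h op \<Rightarrow> complex) set)"
    by fast
  fix f :: "'h op \<Rightarrow> complex"
  assume "f \<in> predual_BH"
  then obtain x y where f: "f = (\<lambda>b. \<Sum>n. cinner (blinfun_apply b (x n)) (y n))"
    and x: "summable (\<lambda>n::nat. (norm (x n))\<^sup>2)" and y: "summable (\<lambda>n. (norm (y n))\<^sup>2)"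
    by (auto simp: predual_BH_def)
  show "(f \<longlongrightarrow> f 0) F"
  proof (cases "F = bot")
    case False
    \<comment> \<open>On the operators of norm at most \<open>M\<close> the series is dominated by
      \<open>g\<close>, by Cauchy-Schwarz and the bound of a product by the sum of squares.
      Tannery's theorem then exchanges the limit along \<open>F\<close> with the sum.\<close>
    define g where "g n = \<bar>M\<bar> * ((norm (x n))\<^sup>2 + (norm (y n))\<^sup>2)" for n
    have le: "cmod (cinner (blinfun_apply b (x n)) (y n)) \<le> g n" if "norm b \<le> M" for b n
    proof -
      have "cmod (cinner (blinfun_apply b (x n)) (y n)) \<le> norm (blinfun_apply b (x n)) * norm (y n)"
        by (rule Cauchy_Schwarz_cinner)
      also have "\<dots> \<le> (norm b * norm (x n)) * norm (y n)"
        by (intro mult_right_mono norm_blinfun) simp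
      also have "\<dots> \<le> \<bar>M\<bar> * (norm (x n) * norm (y n))"
        using that by (simp add: mult.assoc mult_right_mono)
      also have "\<dots> \<le> g n"
        unfolding g_def
        using sum_squares_bound[of "norm (x n)" "norm (y n)"]
          mult_nonneg_nonneg[OF norm_ge_zero[of "x n"] norm_ge_zero[of "y n"]]
        by (intro mult_left_mono) linarith+
      finally show ?thesis .
    qed
    have "((\<lambda>b. \<Sum>n. cinner (blinfun_apply b (x n)) (y n)) \<longlongrightarrow> (\<Sum>n. 0)) F"
    proof (rule tannerys_theorem[THEN conjunct2, THEN conjunct2])
      show "summable g"
        unfolding g_def by (intro summable_mult summable_add x y)
      show "\<forall>\<^sub>F (n, b) in sequentially \<times>\<^sub>F F. norm (cinner (blinfun_apply b (x n)) (y n)) \<le> g n"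
        unfolding eventually_prod_filter
        by (rule exI[of _ "\<lambda>_. True"], rule exI[of _ "\<lambda>b. norm b \<le> M"])
          (use bounded le in simp)
    qed (use weak False in auto)
    then show ?thesis
      by (simp add: f)
  qed simp
qed (rule BH)

theorem proposition4p2:
  fixes T A :: "'h::chilbert_space op set" and \<Gamma> :: "'h set"
  assumes "unital_cstar_subalgebra T"
    and "unital_closed_subalgebra A"
    and "A \<subseteq> T"
    and "compact_operators \<subseteq> T"
    and "closure \<Gamma> = UNIV"
    and "\<And>x. x \<in> \<Gamma> \<Longrightarrow> \<not> cyclic_vector (adj ` A) x"
  shows "(\<forall>h k. zero_ext T (\<lambda>t. cinner (blinfun_apply t h) k) \<in> AC T (Delta T A)) \<and>
    analytic_triple A T"
proof -
  interpret operator_cstar_algebra_with_compacts T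
    by unfold_locales (fact assms)+
  have AC: "vf h k \<in> AC T (Delta T A)" for h k
    by (rule vector_functional_in_AC[OF assms(2,3,5,6)])
  have "analytic_triple A T"
    unfolding analytic_triple_def
  proof (intro allI impI)
    fix F :: "'h op filter"
    assume "\<exists>M. \<forall>\<^sub>F b in F. b \<in> A \<and> norm b \<le> M" and lim: "\<forall>\<alpha>\<in>AC T (Delta T A). (\<alpha> \<longlongrightarrow> 0) F"
    then obtain M where A: "\<forall>\<^sub>F b in F. b \<in> A" and M: "\<forall>\<^sub>F b in F. norm b \<le> M"
      by (auto simp: eventually_conj_iff)
    \<comment> \<open>The functionals are extended by zero outside \<open>T\<close>, so they agree
      with the matrix coefficients only once the net is in \<open>T\<close>.\<close>
    have T: "\<forall>\<^sub>F b in F. b \<in> T"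
      using A by eventually_elim (use assms(3) in blast)
    show "limitin weak_star_BH (\<lambda>b. b) 0 F"
    proof (rule bounded_net_tendsto_weak_star_BH[OF M])
      show "\<forall>\<^sub>F b in F. b \<in> BH"
        using T by eventually_elim (rule in_BH)
      fix h k
      have "(vf h k \<longlongrightarrow> 0) F"
        using AC lim by blast
      moreover have "\<forall>\<^sub>F b in F. vf h k b = cinner (blinfun_apply b h) k"
        using T by eventually_elim (rule vector_functional_apply)
      ultimately show "((\<lambda>b. cinner (blinfun_apply b h) k) \<longlongrightarrow> 0) F"
        by (rule Lim_transform_eventually)
    qed
  qed
  then show ?thesis
    using AC by (simp add: vector_functional_def)
qed

end
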